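(* Let $n\ge 0$, let $p_1,\dots,p_n\in\mathbb{R}^2$ be distinct points, and let $u:\mathbb{R}^2\setminus\{p_1,\dots,p_n\}\to\mathbb{R}$ be a (real) analytic solution of $u_{xx}u_{yy}-u_{xy}^2=0$ with isolated singularities at the points $p_i$. Then either there is no singular point ($n=0$) and $u$ is a cylindrical function in $\mathbb{R}^2$, or there is a unique singular point ($n=1$) and $u$ is a conical function in $\mathbb{R}^2\setminus\{p_1\}$.
   Context: "$u$ has an isolated singularity at $p_i$" means that $u$ cannot be extended to $p_i$ as a $\mathcal{C}^2$ function. A function $u$ is cylindrical in $\mathbb{R}^2$ if there are an orthonormal basis $\{e_1,e_2\}$ of $\mathbb{R}^2$, a constant $v_0\in\mathbb{R}$ and a $\mathcal{C}^2$ function $\alpha:\mathbb{R}\to\mathbb{R}$ such that $u(xe_1+ye_2)=\alpha(x)+v_0\,y$ for all $x,y\in\mathbb{R}$. A function $u$ is conical in $\mathbb{R}^2\setminus\{p\}$ if there are a constant $u_0\in\mathbb{R}$ and a ($2\pi$-periodic) $\mathcal{C}^2$ function $\alpha$ such that $u(p+\rho(\cos\theta,\sin\theta))=u_0+\rho\,\alpha(\theta)$ for all $\rho>0$ and $\theta\in\mathbb{R}$. *)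

theory Defs
  imports "HOL-Analysis.Analysis"
begin

text \<open>
  The plane is \<^typ>\<open>real \<times> real\<close>, whose library norm and inner product are the Euclidean ones.
  A function on a subset of the plane is a total function whose values off that subset are junk;
  on an open set, none of the notions below depends on those values.
\<close>

definition partial_x :: "(real \<times> real \<Rightarrow> real) \<Rightarrow> real \<times> real \<Rightarrow> real" where
  "partial_x u = (\<lambda>(x, y). deriv (\<lambda>t. u (t, y)) x)"

definition partial_y :: "(real \<times> real \<Rightarrow> real) \<Rightarrow> real \<times> real \<Rightarrow> real" where
  "partial_y u = (\<lambda>(x, y). deriv (\<lambda>t. u (x, t)) y)"

definition real_analytic_on :: "(real \<times> real) set \<Rightarrow> (real \<times> real \<Rightarrow> real) \<Rightarrow> bool" where
  "real_analytic_on D u \<longleftrightarrow>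
     (\<forall>(a, b) \<in> D. \<exists>c :: nat \<Rightarrow> nat \<Rightarrow> real. \<exists>r > 0. \<forall>x y. \<bar>x - a\<bar> < r \<longrightarrow> \<bar>y - b\<bar> < r \<longrightarrow>
        ((\<lambda>(i, j). c i j * (x - a) ^ i * (y - b) ^ j) has_sum u (x, y)) UNIV)"

text \<open>Twice continuously Frechet differentiable; \<^term>\<open>D\<close> is meant to be open.\<close>

definition C2_on :: "'a::real_normed_vector set \<Rightarrow> ('a \<Rightarrow> real) \<Rightarrow> bool" where
  "C2_on D f \<longleftrightarrow>
     (\<exists>(f' :: 'a \<Rightarrow> 'a \<Rightarrow>\<^sub>L real) (f'' :: 'a \<Rightarrow> 'a \<Rightarrow>\<^sub>L 'a \<Rightarrow>\<^sub>L real).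
        (\<forall>x\<in>D. (f has_derivative blinfun_apply (f' x)) (at x)) \<and>
        (\<forall>x\<in>D. (f' has_derivative blinfun_apply (f'' x)) (at x)) \<and>
        continuous_on D f'')"

definition singular_at :: "(real \<times> real) set \<Rightarrow> (real \<times> real \<Rightarrow> real) \<Rightarrow> real \<times> real \<Rightarrow> bool" where
  "singular_at D u q \<longleftrightarrow> \<not> (\<exists>v. (\<forall>z\<in>D. v z = u z) \<and> C2_on (insert q D) v)"

definition cylindrical :: "(real \<times> real \<Rightarrow> real) \<Rightarrow> bool" where
  "cylindrical u \<longleftrightarrow>
     (\<exists>(e1 :: real \<times> real) (e2 :: real \<times> real) (v0 :: real) (\<alpha> :: real \<Rightarrow> real).
        norm e1 = 1 \<and> norm e2 = 1 \<and> e1 \<bullet> e2 = 0 \<and> C2_on UNIV \<alpha> \<and>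
        (\<forall>x y. u (x *\<^sub>R e1 + y *\<^sub>R e2) = \<alpha> x + v0 * y))"

definition conical :: "real \<times> real \<Rightarrow> (real \<times> real \<Rightarrow> real) \<Rightarrow> bool" where
  "conical p u \<longleftrightarrow>
     (\<exists>(u0 :: real) (\<alpha> :: real \<Rightarrow> real).
        C2_on UNIV \<alpha> \<and> (\<forall>\<theta>. \<alpha> (\<theta> + 2 * pi) = \<alpha> \<theta>) \<and>
        (\<forall>\<rho> > 0. \<forall>\<theta>. u (p + \<rho> *\<^sub>R (cos \<theta>, sin \<theta>)) = u0 + \<rho> * \<alpha> \<theta>))"

end

theory Submission
  imports Defs "HOL-Complex_Analysis.Complex_Analysis"
begin

text \<open>
  Where the Hessian of \<open>u\<close> does not vanish, its kernel is a line field whose integral curves are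
  straight, and \<open>\<nabla>u\<close> is constant along them; by analyticity it is constant along the whole line as
  long as the line avoids the finite singular set \<open>F\<close>. Either some \<open>q \<in> F\<close> lies on the kernel lines
  of an open set of points, and then \<open>D\<^sup>2u(z) (z - q) = 0\<close> everywhere by the identity theorem; or the
  kernel lines of some open set all avoid \<open>F\<close>, and then they are parallel to a vector \<open>v\<close>, so that
  \<open>D\<^sup>2u(z) v = 0\<close> everywhere.

  In both cases \<open>D\<^sup>2u\<close> annihilates an affine field \<open>X(z) = e + k z\<close> with \<open>k \<in> {0, 1}\<close>. Then
  \<open>X \<cdot> \<nabla>u - k u\<close> is a constant \<open>C\<close> and \<open>u(z + s X(z)) = (1 + k s) u(z) + s C\<close>. This extends \<open>u\<close>
  analytically across every singular point at which \<open>X\<close> does not vanish: no singularity is left if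
  \<open>k = 0\<close>, and only \<open>q\<close> if \<open>k = 1\<close>. The formula itself is the cylindrical or conical form.
\<close>

section \<open>Power series in two variables\<close>

text \<open>The series of \<open>real_analytic_on\<close> written in the displacement from its
  centre, with coefficients and radius explicit so that differentiation and affine substitution can
  be followed on them.\<close>

definition has_power_series_at ::
    "(real \<times> real \<Rightarrow> real) \<Rightarrow> (nat \<Rightarrow> nat \<Rightarrow> real) \<Rightarrow> real \<Rightarrow> real \<times> real \<Rightarrow> bool" where
  "has_power_series_at u c r z \<longleftrightarrow> 0 < r \<and>
     (\<forall>x y. \<bar>x\<bar> < r \<longrightarrow> \<bar>y\<bar> < r \<longrightarrow>
        ((\<lambda>(i, j). c i j * x ^ i * y ^ j) has_sum u (z + (x, y))) UNIV)"

lemma real_analytic_on_iff: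
  "real_analytic_on D u \<longleftrightarrow> (\<forall>z\<in>D. \<exists>c r. has_power_series_at u c r z)"
proof -
  have shift: "(\<forall>x y. \<bar>x - a\<bar> < r \<longrightarrow> \<bar>y - b\<bar> < r \<longrightarrow>
          ((\<lambda>(i, j). c i j * (x - a) ^ i * (y - b) ^ j) has_sum u (x, y)) UNIV) \<longleftrightarrow>
        (\<forall>x y. \<bar>x\<bar> < r \<longrightarrow> \<bar>y\<bar> < r \<longrightarrow>
          ((\<lambda>(i, j). c i j * x ^ i * y ^ j) has_sum u ((a, b) + (x, y))) UNIV)"
    (is "?L \<longleftrightarrow> ?R") for a b r :: real and c :: "nat \<Rightarrow> nat \<Rightarrow> real"
  proof
    assume L: ?L
    show ?R
    proof (intro allI impI)
      fix x y :: real assume "\<bar>x\<bar> < r" "\<bar>y\<bar> < r"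
      with L[rule_format, of "a + x" "b + y"]
      show "((\<lambda>(i, j). c i j * x ^ i * y ^ j) has_sum u ((a, b) + (x, y))) UNIV" by simp
    qed
  next
    assume R: ?R
    show ?L
    proof (intro allI impI)
      fix x y :: real assume "\<bar>x - a\<bar> < r" "\<bar>y - b\<bar> < r"
      with R[rule_format, of "x - a" "y - b"]
      show "((\<lambda>(i, j). c i j * (x - a) ^ i * (y - b) ^ j) has_sum u (x, y)) UNIV" by simp
    qed
  qed
  show ?thesis
    unfolding real_analytic_on_def
  proof (rule ball_cong[OF refl])
    fix z :: "real \<times> real"
    obtain a b where z: "z = (a, b)" by (cases z)
    show "(case z of (a, b) \<Rightarrow> \<exists>c. \<exists>r>0. \<forall>x y. \<bar>x - a\<bar> < r \<longrightarrow> \<bar>y - b\<bar> < r \<longrightarrow>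
        ((\<lambda>(i, j). c i j * (x - a) ^ i * (y - b) ^ j) has_sum u (x, y)) UNIV) \<longleftrightarrow>
      (\<exists>c r. has_power_series_at u c r z)"
      unfolding z prod.case shift has_power_series_at_def ..
  qed
qed

text \<open>
  Complexification makes termwise differentiation and the one-dimensional identity theorem
  available from the theory of holomorphic functions.
\<close>

definition complex_series :: "(nat \<Rightarrow> nat \<Rightarrow> real) \<Rightarrow> complex \<times> complex \<Rightarrow> complex" where
  "complex_series c w = (\<Sum>\<^sub>\<infinity>k. of_real (c (fst k) (snd k)) * fst w ^ fst k * snd w ^ snd k)"

text \<open>Convergence at the single real point \<open>(s, s)\<close> suffices: unconditional
  summability of reals is absolute, and the terms there dominate those on the whole closed bidisc of
  radius \<open>s\<close>.\<close>

lemma complex_series_uniform_limit: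
  assumes u: "has_power_series_at u c r z" and s: "0 < s" "s < r"
  shows "uniform_limit {w. norm (fst w) \<le> s \<and> norm (snd w) \<le> s}
           (\<lambda>K w. \<Sum>k\<in>K. of_real (c (fst k) (snd k)) * fst w ^ fst k * snd w ^ snd k)
           (complex_series c) (finite_subsets_at_top UNIV)"
  unfolding complex_series_def
proof (rule Weierstrass_m_test_general)
  show "(\<lambda>k. norm (c (fst k) (snd k) * s ^ fst k * s ^ snd k)) summable_on UNIV"
  proof -
    have "((\<lambda>(i, j). c i j * s ^ i * s ^ j) has_sum u (z + (s, s))) UNIV"
      using u s unfolding has_power_series_at_def by auto
    then have "(\<lambda>k. c (fst k) (snd k) * s ^ fst k * s ^ snd k) summable_on UNIV"
      by (intro has_sum_imp_summable) (simp add: case_prod_beta')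
    then show ?thesis
      by (rule summable_on_iff_abs_summable_on_real[THEN iffD1])
  qed
next
  fix k :: "nat \<times> nat" and w :: "complex \<times> complex"
  assume "w \<in> {w. norm (fst w) \<le> s \<and> norm (snd w) \<le> s}"
  then show "norm (of_real (c (fst k) (snd k)) * fst w ^ fst k * snd w ^ snd k)
      \<le> norm (c (fst k) (snd k) * s ^ fst k * s ^ snd k)"
    using s by (auto simp: norm_mult norm_power abs_mult intro!: mult_mono power_mono)
qed

lemma complex_series_of_real:
  assumes "has_power_series_at u c r z" and "\<bar>x\<bar> < r" "\<bar>y\<bar> < r"
  shows "complex_series c (of_real x, of_real y) = of_real (u (z + (x, y)))"
proof -
  have "((\<lambda>(i, j). c i j * x ^ i * y ^ j) has_sum u (z + (x, y))) UNIV"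
    using assms unfolding has_power_series_at_def by auto
  from has_sum_of_real[OF this, where 'a = complex] show ?thesis
    unfolding complex_series_def by (intro infsumI) (simp add: case_prod_beta)
qed

text \<open>The complexified series is a uniform limit of polynomials on a closed bidisc, and
  \<open>u\<close> is its restriction to real points.\<close>

lemma has_power_series_at_imp_isCont:
  assumes u: "has_power_series_at u c r z"
  shows "isCont u z"
proof -
  have r: "0 < r" using u by (simp add: has_power_series_at_def)
  define s where "s = r / 2"
  have s: "0 < s" "s < r" using r by (auto simp: s_def)
  let ?A = "{w :: complex \<times> complex. norm (fst w) \<le> s \<and> norm (snd w) \<le> s}"
  have "continuous_on ?A (complex_series c)"
    by (rule uniform_limit_theorem[OF _ complex_series_uniform_limit[OF u s]])
       (auto intro!: always_eventually continuous_intros)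
  moreover have bound: "\<bar>fst (w - z)\<bar> \<le> s \<and> \<bar>snd (w - z)\<bar> \<le> s" if "w \<in> ball z s" for w
  proof -
    have "norm (w - z) < s" using that by (simp add: dist_norm norm_minus_commute)
    moreover have "\<bar>fst (w - z)\<bar> \<le> norm (w - z)" "\<bar>snd (w - z)\<bar> \<le> norm (w - z)"
      by (metis norm_fst_le norm_snd_le prod.collapse real_norm_def)+
    ultimately show ?thesis
      by simp
  qed
  ultimately have "continuous_on (ball z s)
      (\<lambda>w. complex_series c (of_real (fst (w - z)), of_real (snd (w - z))))"
    by (intro continuous_on_compose2[of ?A "complex_series c" "ball z s"
          "\<lambda>w. (of_real (fst (w - z)), of_real (snd (w - z)))"])
       (auto intro!: continuous_intros simp flip: of_real_diff)
  then have "continuous_on (ball z s)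
      (\<lambda>w. Re (complex_series c (of_real (fst (w - z)), of_real (snd (w - z)))))"
    by (rule continuous_on_Re)
  then have "continuous_on (ball z s) u"
  proof (rule continuous_on_eq)
    fix w assume "w \<in> ball z s"
    then have "\<bar>fst (w - z)\<bar> < r" "\<bar>snd (w - z)\<bar> < r"
      using bound[of w] s by auto
    from complex_series_of_real[OF u this]
    show "Re (complex_series c (of_real (fst (w - z)), of_real (snd (w - z)))) = u w"
      by (cases w; cases z) simp
  qed
  then show ?thesis
    using s by (simp add: continuous_on_eq_continuous_at)
qed

text \<open>With \<open>y\<close> fixed, the partial sums are polynomials in one complex variable
  that converge uniformly on a disc about \<open>x\<close>; their derivatives then converge to the
  derivative of the limit.\<close>

lemma has_power_series_at_partial_x_aux:
  assumes u: "has_power_series_at u c r z" and xy: "\<bar>x\<bar> < r" "\<bar>y\<bar> < r"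
  obtains d where "((\<lambda>t. u (z + (t, y))) has_real_derivative d) (at x)"
    and "((\<lambda>(i, j). real (Suc i) * c (Suc i) j * x ^ i * y ^ j) has_sum d) UNIV"
proof -
  \<comment> \<open>Any \<open>s\<close> strictly between the larger of the two moduli and
    \<open>r\<close> will do; the disc of radius \<open>s - \<bar>x\<bar>\<close> about
    \<open>x\<close> then stays inside the disc of radius \<open>s\<close> about 0.\<close>
  define s where "s = (max \<bar>x\<bar> \<bar>y\<bar> + r) / 2"
  have s: "\<bar>x\<bar> < s" "\<bar>y\<bar> < s" "0 < s" "s < r" using xy by (auto simp: s_def)
  define e where "e = s - \<bar>x\<bar>"
  have e: "0 < e" using s by (simp add: e_def)
  let ?f = "\<lambda>K w. \<Sum>k\<in>K. of_real (c (fst k) (snd k)) * w ^ fst k * (of_real y :: complex) ^ snd k"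
  let ?f' = "\<lambda>K w. \<Sum>k\<in>K. of_real (c (fst k) (snd k)) * (of_nat (fst k) * w ^ (fst k - 1)) * (of_real y :: complex) ^ snd k"
  have "norm w \<le> s" if "w \<in> cball (of_real x) e" for w :: complex
    using that norm_triangle_ineq2[of w "of_real x"]
    by (simp add: e_def dist_norm norm_minus_commute)
  then have "uniform_limit (cball (of_real x) e) ?f (\<lambda>w. complex_series c (w, of_real y))
      (finite_subsets_at_top UNIV)"
    using s uniform_limit_compose'[OF complex_series_uniform_limit[OF u s(3,4)],
      of "\<lambda>w. (w, of_real y)" "cball (of_real x) e"] by auto
  moreover have "\<forall>\<^sub>F K in finite_subsets_at_top UNIV. continuous_on (cball (of_real x) e) (?f K) \<and>
      (\<forall>w\<in>ball (of_real x) e. (?f K has_field_derivative ?f' K w) (at w))"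
    by (intro always_eventually allI conjI ballI continuous_intros DERIV_sum)
       (auto intro!: derivative_eq_intros)
  ultimately obtain g' where
    g': "\<And>w. w \<in> ball (of_real x) e \<Longrightarrow>
          ((\<lambda>w. complex_series c (w, of_real y)) has_field_derivative g' w) (at w) \<and>
          ((\<lambda>K. ?f' K w) \<longlongrightarrow> g' w) (finite_subsets_at_top UNIV)"
    using has_complex_derivative_uniform_limit[OF _ _ finite_subsets_at_top_neq_bot e, of "of_real x" ?f ?f'
      UNIV "\<lambda>w. complex_series c (w, of_real y)"] by blast
  define d where "d = Re (g' (of_real x))"
  have D: "((\<lambda>w. complex_series c (w, of_real y)) has_field_derivative g' (of_real x)) (at (of_real x))"
    and L: "((\<lambda>K. ?f' K (of_real x)) \<longlongrightarrow> g' (of_real x)) (finite_subsets_at_top UNIV)"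
    using g'[of "of_real x"] e by auto
  have "((\<lambda>t. Re (complex_series c (of_real t, of_real y))) has_real_derivative d) (at x)"
    unfolding d_def has_real_derivative_iff_has_vector_derivative
    using bounded_linear.has_vector_derivative[OF bounded_linear_Re has_vector_derivative_real_field[OF D]] .
  then have 1: "((\<lambda>t. u (z + (t, y))) has_real_derivative d) (at x)"
    by (rule has_field_derivative_transform_within_open[of _ _ _ "{-r<..<r}"])
       (use xy complex_series_of_real[OF u] in auto)
  let ?h = "\<lambda>k :: nat \<times> nat. c (fst k) (snd k) * (of_nat (fst k) * x ^ (fst k - 1)) * y ^ snd k"
  have "(\<lambda>K. Re (?f' K (of_real x))) = sum ?h"
  proof
    fix K
    have "?f' K (of_real x) = of_real (sum ?h K)" by simp
    then show "Re (?f' K (of_real x)) = sum ?h K" by (metis Re_complex_of_real)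
  qed
  then have "(?h has_sum d) UNIV"
    using tendsto_Re[OF L] unfolding has_sum_def d_def by simp
  \<comment> \<open>The terms with first exponent 0 vanish after differentiation, so the sum lives
    on the image of the index shift.\<close>
  then have "(?h has_sum d) (range (\<lambda>(i, j). (Suc i, j)))"
  proof (subst has_sum_cong_neutral[where T = UNIV and g = ?h])
    fix k :: "nat \<times> nat" assume "k \<in> UNIV - range (\<lambda>(i, j). (Suc i, j))"
    then have "fst k = 0"
      by (cases k; cases "fst k") (auto simp: image_iff)
    then show "?h k = 0" by simp
  qed auto
  moreover have "inj (\<lambda>(i :: nat, j :: nat). (Suc i, j))"
    by (auto simp: inj_on_def)
  moreover have "?h \<circ> (\<lambda>(i, j). (Suc i, j)) = (\<lambda>(i, j). real (Suc i) * c (Suc i) j * x ^ i * y ^ j)"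
    by (auto simp: fun_eq_iff)
  ultimately have 2: "((\<lambda>(i, j). real (Suc i) * c (Suc i) j * x ^ i * y ^ j) has_sum d) UNIV"
    by (simp only: has_sum_reindex)
  from 1 2 show thesis by (rule that)
qed

lemma has_power_series_at_has_partial_x:
  assumes "has_power_series_at u c r z" and "\<bar>x\<bar> < r" "\<bar>y\<bar> < r"
  shows "((\<lambda>t. u (z + (t, y))) has_real_derivative partial_x u (z + (x, y))) (at x)"
    and "((\<lambda>(i, j). real (Suc i) * c (Suc i) j * x ^ i * y ^ j) has_sum partial_x u (z + (x, y))) UNIV"
proof -
  obtain d where d: "((\<lambda>t. u (z + (t, y))) has_real_derivative d) (at x)"
    and sd: "((\<lambda>(i, j). real (Suc i) * c (Suc i) j * x ^ i * y ^ j) has_sum d) UNIV"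
    using has_power_series_at_partial_x_aux[OF assms] .
  obtain a b where z: "z = (a, b)" by (cases z)
  have "((\<lambda>t. u (t, b + y)) has_real_derivative d) (at (x + a))"
    using d by (subst DERIV_shift) (simp add: z add.commute)
  then have "partial_x u (z + (x, y)) = d"
    by (simp add: partial_x_def z DERIV_imp_deriv add.commute)
  with d sd show
    "((\<lambda>t. u (z + (t, y))) has_real_derivative partial_x u (z + (x, y))) (at x)"
    "((\<lambda>(i, j). real (Suc i) * c (Suc i) j * x ^ i * y ^ j) has_sum partial_x u (z + (x, y))) UNIV"
    by simp_all
qed

lemma has_power_series_at_partial_x:
  assumes "has_power_series_at u c r z"
  shows "has_power_series_at (partial_x u) (\<lambda>i j. real (Suc i) * c (Suc i) j) r z"
  using assms has_power_series_at_has_partial_x(2)[OF assms]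
  unfolding has_power_series_at_def by blast

text \<open>Exchanging the coordinates reduces every statement about \<open>partial_y\<close> to one
  about \<open>partial_x\<close>.\<close>

lemma has_power_series_at_swap:
  assumes "has_power_series_at u c r z"
  shows "has_power_series_at (u \<circ> prod.swap) (\<lambda>i j. c j i) r (prod.swap z)"
  unfolding has_power_series_at_def
proof (intro conjI allI impI)
  show "0 < r" using assms by (simp add: has_power_series_at_def)
  fix x y :: real assume "\<bar>x\<bar> < r" "\<bar>y\<bar> < r"
  then have "((\<lambda>(i, j). c i j * y ^ i * x ^ j) has_sum u (z + (y, x))) (UNIV \<times> UNIV)"
    using assms unfolding has_power_series_at_def by auto
  then have "((\<lambda>(i, j). c j i * y ^ j * x ^ i) has_sum u (z + (y, x))) (UNIV \<times> UNIV)"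
    by (subst (asm) has_sum_swap) (simp add: case_prod_beta)
  moreover have "prod.swap (prod.swap z + (x, y)) = z + (y, x)"
    by (cases z) simp
  ultimately show "((\<lambda>(i, j). c j i * x ^ i * y ^ j) has_sum (u \<circ> prod.swap) (prod.swap z + (x, y))) UNIV"
    by (simp add: case_prod_beta mult_ac)
qed

lemma partial_y_conv_partial_x: "partial_y u = partial_x (u \<circ> prod.swap) \<circ> prod.swap"
  by (auto simp: partial_x_def partial_y_def)

lemma has_power_series_at_partial_y:
  assumes "has_power_series_at u c r z"
  shows "has_power_series_at (partial_y u) (\<lambda>i j. real (Suc j) * c i (Suc j)) r z"
  using has_power_series_at_swap[OF has_power_series_at_partial_x[OF has_power_series_at_swap[OF assms]]]
  by (simp add: partial_y_conv_partial_x)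

lemma has_power_series_at_center:
  assumes "has_power_series_at u c r z"
  shows "u z = c 0 0"
proof -
  have "((\<lambda>(i, j). c i j * 0 ^ i * 0 ^ j) has_sum u (z + (0, 0))) UNIV"
    using assms unfolding has_power_series_at_def by auto
  moreover have "((\<lambda>(i, j). c i j * 0 ^ i * 0 ^ j) has_sum c 0 0) UNIV"
    by (rule has_sum_finite_neutralI[of "{(0, 0)}"]) (auto simp: power_0_left split: if_splits)
  ultimately have "u (z + (0, 0)) = c 0 0"
    by (rule has_sum_unique)
  then show ?thesis by (simp flip: zero_prod_def)
qed

lemma real_analytic_on_partial_x: "real_analytic_on D u \<Longrightarrow> real_analytic_on D (partial_x u)"
  and real_analytic_on_partial_y: "real_analytic_on D u \<Longrightarrow> real_analytic_on D (partial_y u)"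
  unfolding real_analytic_on_iff
  using has_power_series_at_partial_x has_power_series_at_partial_y by blast+

lemma real_analytic_on_imp_isCont: "real_analytic_on D u \<Longrightarrow> z \<in> D \<Longrightarrow> isCont u z"
  unfolding real_analytic_on_iff using has_power_series_at_imp_isCont by blast

text \<open>Both mixed derivatives at the centre of a series are its coefficient
  \<open>c 1 1\<close>.\<close>

lemma real_analytic_on_partial_commute:
  assumes "real_analytic_on D u" "z \<in> D"
  shows "partial_y (partial_x u) z = partial_x (partial_y u) z"
proof -
  obtain c r where u: "has_power_series_at u c r z"
    using assms unfolding real_analytic_on_iff by blast
  show ?thesis
    using has_power_series_at_center[OF has_power_series_at_partial_y[OF has_power_series_at_partial_x[OF u]]]
      has_power_series_at_center[OF has_power_series_at_partial_x[OF has_power_series_at_partial_y[OF u]]]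
    by simp
qed

text \<open>Analyticity is local. This serves functions glued from two formulas, as in the extension
  across a singular point; the new radius is that of a square about \<open>z\<close> inside
  \<open>N\<close>.\<close>

lemma has_power_series_at_transform:
  assumes u: "has_power_series_at u c r z" and N: "open N" "z \<in> N" "\<And>w. w \<in> N \<Longrightarrow> v w = u w"
  obtains r' where "has_power_series_at v c r' z"
proof -
  obtain a b where ab: "z = (a, b)" by (cases z)
  obtain X Y where XY: "open X" "open Y" "z \<in> X \<times> Y" "X \<times> Y \<subseteq> N"
    using open_prod_elim[OF N(1,2)] by blast
  obtain d e where de: "0 < d" "ball a d \<subseteq> X" "0 < e" "ball b e \<subseteq> Y"
    using XY ab open_contains_ball[of X] open_contains_ball[of Y] by (metis mem_Sigma_iff)
  define r' where "r' = Min {r, d, e}"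
  have "z + (x, y) \<in> N" if "\<bar>x\<bar> < r'" "\<bar>y\<bar> < r'" for x y
  proof -
    have "a + x \<in> ball a d" "b + y \<in> ball b e" using that by (auto simp: r'_def dist_real_def)
    then have "(a + x, b + y) \<in> N" using de XY(4) by blast
    then show ?thesis by (simp add: ab)
  qed
  with u de N(3) have "has_power_series_at v c r' z"
    unfolding has_power_series_at_def by (auto simp: r'_def)
  then show thesis by (rule that)
qed

text \<open>A dilation by \<open>l\<close> multiplies the coefficient at \<open>(i, j)\<close> by
  the power \<open>i + j\<close> of \<open>l\<close> and divides the radius by its modulus. In this
  form \<open>u\<close> near a singular point is later expressed by \<open>u\<close> near a regular
  one.\<close>

lemma has_power_series_at_affine:
  assumes u: "has_power_series_at u c r (m + l *\<^sub>R z)" and l: "l \<noteq> 0"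
  shows "has_power_series_at (\<lambda>w. A * u (m + l *\<^sub>R w) + K)
    (\<lambda>i j. A * (c i j * l ^ i * l ^ j) + (if i = 0 \<and> j = 0 then K else 0)) (r / \<bar>l\<bar>) z"
  unfolding has_power_series_at_def
proof (intro conjI allI impI)
  show "0 < r / \<bar>l\<bar>" using u l by (simp add: has_power_series_at_def)
  fix x y :: real assume "\<bar>x\<bar> < r / \<bar>l\<bar>" "\<bar>y\<bar> < r / \<bar>l\<bar>"
  then have "\<bar>l * x\<bar> < r" "\<bar>l * y\<bar> < r" using l by (auto simp: field_simps abs_mult)
  then have "((\<lambda>(i, j). c i j * (l * x) ^ i * (l * y) ^ j) has_sum u (m + l *\<^sub>R z + (l * x, l * y))) UNIV"
    using u unfolding has_power_series_at_def by blast
  then have "((\<lambda>k. A * (case k of (i, j) \<Rightarrow> c i j * (l * x) ^ i * (l * y) ^ j)) has_sum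
      A * u (m + l *\<^sub>R z + (l * x, l * y))) UNIV"
    by (rule has_sum_cmult_right)
  moreover have "((\<lambda>(i, j). if i = 0 \<and> j = 0 then K else 0 :: real) has_sum K) (UNIV :: (nat \<times> nat) set)"
    by (rule has_sum_finite_neutralI[of "{(0, 0)}"]) (auto split: if_splits)
  ultimately have "((\<lambda>k. A * (case k of (i, j) \<Rightarrow> c i j * (l * x) ^ i * (l * y) ^ j) +
      (case k of (i, j) \<Rightarrow> if i = 0 \<and> j = 0 then K else 0)) has_sum
      A * u (m + l *\<^sub>R z + (l * x, l * y)) + K) UNIV"
    by (rule has_sum_add)
  moreover have "m + l *\<^sub>R (z + (x, y)) = m + l *\<^sub>R z + (l * x, l * y)"
    by (cases z; cases m) (simp add: algebra_simps)
  moreover have "(\<lambda>k. A * (case k of (i, j) \<Rightarrow> c i j * (l * x) ^ i * (l * y) ^ j) +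
      (case k of (i, j) \<Rightarrow> if i = 0 \<and> j = 0 then K else 0)) =
      (\<lambda>(i, j). (A * (c i j * l ^ i * l ^ j) + (if i = 0 \<and> j = 0 then K else 0)) * x ^ i * y ^ j)"
    by (auto simp: fun_eq_iff power_mult_distrib)
  ultimately show "((\<lambda>(i, j). (A * (c i j * l ^ i * l ^ j) + (if i = 0 \<and> j = 0 then K else 0)) * x ^ i * y ^ j)
      has_sum A * u (m + l *\<^sub>R (z + (x, y))) + K) UNIV"
    by (simp only:)
qed

section \<open>Identity theorem\<close>

text \<open>The points near which \<open>P\<close> holds form an open set, and \<open>closed\<close>
  makes it relatively closed in \<open>S\<close>. Both identity theorems below are
  instances.\<close>

lemma eventually_nhds_connected:
  assumes "connected S" "x \<in> S" "eventually P (nhds x)" "y \<in> S"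
    and closed: "\<And>z. z \<in> S \<Longrightarrow> z \<in> closure {w. eventually P (nhds w)} \<Longrightarrow> eventually P (nhds z)"
  shows "eventually P (nhds y)"
proof -
  let ?A = "{w. eventually P (nhds w)}"
  have "?A = \<Union>{S. open S \<and> (\<forall>w\<in>S. P w)}"
    by (auto simp: eventually_nhds)
  then have "open ?A"
    by (simp add: open_Union)
  show ?thesis
  proof (rule ccontr)
    assume "\<not> ?thesis"
    then have "y \<in> - closure ?A \<inter> S" using closed[of y] assms by auto
    moreover have "x \<in> ?A \<inter> S" using assms by auto
    moreover have "S \<subseteq> ?A \<union> - closure ?A" using closed by auto
    moreover have "?A \<inter> - closure ?A \<inter> S = {}" using closure_subset[of ?A] by blast
    ultimately show False
      using connectedD[OF \<open>connected S\<close> \<open>open ?A\<close>, of "- closure ?A"] by (auto simp: open_Compl)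
  qed
qed

section \<open>Real analytic functions of one variable\<close>

text \<open>A local holomorphic extension takes the place of a real power series, so that sums,
  products and the identity theorem are inherited from complex analysis.\<close>

definition real_analytic_at :: "(real \<Rightarrow> real) \<Rightarrow> real \<Rightarrow> bool" where
  "real_analytic_at f t \<longleftrightarrow> (\<exists>F. F analytic_on {of_real t} \<and>
     (\<forall>\<^sub>F s in nhds t. F (of_real s) = complex_of_real (f s)))"

lemma real_analytic_at_const: "real_analytic_at (\<lambda>s. k) t"
  unfolding real_analytic_at_def by (rule exI[of _ "\<lambda>_. of_real k"]) (auto intro!: analytic_intros)

lemma real_analytic_at_ident: "real_analytic_at (\<lambda>s. s) t"
  unfolding real_analytic_at_def by (rule exI[of _ "\<lambda>s. s"]) (auto intro!: analytic_intros)

lemma real_analytic_at_add: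
  assumes "real_analytic_at f t" "real_analytic_at g t"
  shows "real_analytic_at (\<lambda>s. f s + g s) t"
proof -
  obtain F G where "F analytic_on {of_real t}" "G analytic_on {of_real t}"
    and F: "\<forall>\<^sub>F s in nhds t. F (of_real s) = complex_of_real (f s)"
    and G: "\<forall>\<^sub>F s in nhds t. G (of_real s) = complex_of_real (g s)"
    using assms unfolding real_analytic_at_def by blast
  moreover have "\<forall>\<^sub>F s in nhds t. F (of_real s) + G (of_real s) = complex_of_real (f s + g s)"
    using F G by eventually_elim simp
  ultimately show ?thesis
    unfolding real_analytic_at_def
    by (intro exI[of _ "\<lambda>w. F w + G w"]) (auto intro!: analytic_intros)
qed

lemma real_analytic_at_mult:
  assumes "real_analytic_at f t" "real_analytic_at g t"
  shows "real_analytic_at (\<lambda>s. f s * g s) t"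
proof -
  obtain F G where "F analytic_on {of_real t}" "G analytic_on {of_real t}"
    and F: "\<forall>\<^sub>F s in nhds t. F (of_real s) = complex_of_real (f s)"
    and G: "\<forall>\<^sub>F s in nhds t. G (of_real s) = complex_of_real (g s)"
    using assms unfolding real_analytic_at_def by blast
  moreover have "\<forall>\<^sub>F s in nhds t. F (of_real s) * G (of_real s) = complex_of_real (f s * g s)"
    using F G by eventually_elim simp
  ultimately show ?thesis
    unfolding real_analytic_at_def
    by (intro exI[of _ "\<lambda>w. F w * G w"]) (auto intro!: analytic_intros)
qed

text \<open>If \<open>t\<close> is a limit of points near which \<open>f\<close> vanishes, the
  holomorphic extension at \<open>t\<close> vanishes on a small real interval inside its disc. Such
  an interval has an accumulation point in the disc, so the extension vanishes on all of it.\<close>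

lemma real_analytic_identity:
  assumes "connected S" and an: "\<And>t. t \<in> S \<Longrightarrow> real_analytic_at f t"
    and "x \<in> S" "\<forall>\<^sub>F s in nhds x. f s = 0" "y \<in> S"
  shows "f y = 0"
proof -
  have "\<forall>\<^sub>F s in nhds y. f s = 0"
  proof (rule eventually_nhds_connected[of S x])
    fix t assume t: "t \<in> S" and cl: "t \<in> closure {w. \<forall>\<^sub>F s in nhds w. f s = 0}"
    obtain F where "F analytic_on {of_real t}"
      and F: "\<forall>\<^sub>F s in nhds t. F (of_real s) = complex_of_real (f s)"
      using an[OF t] unfolding real_analytic_at_def by blast
    then obtain e where e: "0 < e" "F holomorphic_on ball (of_real t) e"
      unfolding analytic_on_def by auto
    obtain d where d: "0 < d" "\<And>s. dist s t < d \<Longrightarrow> F (of_real s) = complex_of_real (f s)"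
      using F unfolding eventually_nhds_metric by blast
    \<comment> \<open>Within \<open>m\<close> of \<open>t\<close>, the extension \<open>F\<close> is
      holomorphic and agrees with \<open>f\<close> at real points.\<close>
    define m where "m = min d e"
    have m: "0 < m" using d e by (simp add: m_def)
    obtain w where w: "\<forall>\<^sub>F s in nhds w. f s = 0" "dist w t < m"
      using cl m unfolding closure_approachable by blast
    obtain \<delta> where \<delta>: "0 < \<delta>" "\<And>s. dist s w < \<delta> \<Longrightarrow> f s = 0"
      using w unfolding eventually_nhds_metric by blast
    let ?V = "ball w \<delta> \<inter> ball t m"
    have "w islimpt ?V"
      by (intro interior_limit_point) (use w \<delta> in \<open>auto simp: interior_open open_Int dist_commute\<close>)
    have "of_real w islimpt (of_real ` ?V :: complex set)"
      unfolding islimpt_approachable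
    proof (intro allI impI)
      fix \<epsilon> :: real assume "0 < \<epsilon>"
      then obtain s where "s \<in> ?V" "s \<noteq> w" "dist s w < \<epsilon>"
        using \<open>w islimpt ?V\<close> unfolding islimpt_approachable by blast
      then show "\<exists>x'\<in>complex_of_real ` ?V. x' \<noteq> of_real w \<and> dist x' (of_real w) < \<epsilon>"
        by (intro bexI[of _ "of_real s"]) (auto simp: dist_of_real)
    qed
    then have "F v = 0" if "v \<in> ball (of_real t) m" for v
    proof (rule analytic_continuation[of F "ball (of_real t) m", rotated 5])
      show "F holomorphic_on ball (of_real t) m"
        by (rule holomorphic_on_subset[OF e(2)]) (auto simp: m_def)
    qed (use w m \<delta> d that in \<open>auto simp: dist_of_real dist_commute m_def\<close>)
    then have "f s = 0" if "dist s t < m" for s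
      using that d(2)[of s] by (simp add: dist_of_real dist_commute m_def)
    then show "\<forall>\<^sub>F s in nhds t. f s = 0"
      using m unfolding eventually_nhds_metric by blast
  qed (use assms in auto)
  then show ?thesis by (rule eventually_nhds_x_imp_x)
qed

section \<open>Planar identity theorem by restriction to lines\<close>

text \<open>
  Weaker than \<^const>\<open>real_analytic_on\<close>, but enough for the identity theorem and evidently closed under
  products.
\<close>

definition analytic_along_lines :: "(real \<times> real) set \<Rightarrow> (real \<times> real \<Rightarrow> real) \<Rightarrow> bool" where
  "analytic_along_lines D f \<longleftrightarrow>
     (\<forall>z d t. z + t *\<^sub>R d \<in> D \<longrightarrow> real_analytic_at (\<lambda>s. f (z + s *\<^sub>R d)) t)"

lemma analytic_along_lines_const: "analytic_along_lines D (\<lambda>_. k)"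
  by (simp add: analytic_along_lines_def real_analytic_at_const)

lemma analytic_along_lines_add:
  "analytic_along_lines D f \<Longrightarrow> analytic_along_lines D g \<Longrightarrow> analytic_along_lines D (\<lambda>z. f z + g z)"
  by (simp add: analytic_along_lines_def real_analytic_at_add)

lemma analytic_along_lines_mult:
  "analytic_along_lines D f \<Longrightarrow> analytic_along_lines D g \<Longrightarrow> analytic_along_lines D (\<lambda>z. f z * g z)"
  by (simp add: analytic_along_lines_def real_analytic_at_mult)

lemma analytic_along_lines_fst: "analytic_along_lines D fst"
  and analytic_along_lines_snd: "analytic_along_lines D snd"
  by (simp_all add: analytic_along_lines_def real_analytic_at_const real_analytic_at_ident
      real_analytic_at_add real_analytic_at_mult)

text \<open>Substituting a complexified line into the double series gives a uniform limit of
  polynomials in one complex variable, hence a holomorphic extension.\<close>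

lemma real_analytic_on_imp_analytic_along_lines:
  assumes "real_analytic_on D u"
  shows "analytic_along_lines D u"
  unfolding analytic_along_lines_def
proof (intro allI impI)
  fix z d :: "real \<times> real" and t :: real
  assume "z + t *\<^sub>R d \<in> D"
  then obtain c r where u: "has_power_series_at u c r (z + t *\<^sub>R d)"
    using assms unfolding real_analytic_on_iff by blast
  then have r: "0 < r" by (simp add: has_power_series_at_def)
  define s where "s = r / 2"
  have s: "0 < s" "s < r" using r by (auto simp: s_def)
  \<comment> \<open>With this radius both components of the displacement along \<open>d\<close> are
    at most \<open>s\<close>; the summand 1 keeps the denominator positive when \<open>d\<close> is
    zero.\<close>
  define e where "e = s / (1 + \<bar>fst d\<bar> + \<bar>snd d\<bar>)"
  have e: "0 < e" using s by (simp add: e_def add_pos_nonneg)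
  have es: "e * \<bar>fst d\<bar> \<le> s" "e * \<bar>snd d\<bar> \<le> s"
    using s by (auto simp: e_def field_simps)
  let ?h = "\<lambda>w :: complex. ((w - of_real t) * of_real (fst d), (w - of_real t) * of_real (snd d))"
  let ?A = "{w :: complex \<times> complex. norm (fst w) \<le> s \<and> norm (snd w) \<le> s}"
  have "?h \<in> cball (of_real t) e \<rightarrow> ?A"
  proof
    fix w :: complex assume "w \<in> cball (of_real t) e"
    then have "norm (w - of_real t) \<le> e"
      by (simp add: dist_norm norm_minus_commute)
    then have "norm (w - of_real t) * \<bar>fst d\<bar> \<le> s" "norm (w - of_real t) * \<bar>snd d\<bar> \<le> s"
      using es by (meson abs_ge_zero mult_right_mono order_trans)+
    then show "?h w \<in> ?A" by (simp add: norm_mult)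
  qed
  note lim = uniform_limit_compose'[OF complex_series_uniform_limit[OF u s] this]
  have "(\<lambda>w. complex_series c (?h w)) holomorphic_on ball (of_real t) e"
    by (rule holomorphic_uniform_limit[OF _ lim])
       (auto intro!: always_eventually continuous_intros holomorphic_intros)
  then have "(\<lambda>w. complex_series c (?h w)) analytic_on {of_real t}"
    using e unfolding analytic_on_def by auto
  moreover have "\<forall>\<^sub>F v in nhds t. complex_series c (?h (of_real v)) = of_real (u (z + v *\<^sub>R d))"
    unfolding eventually_nhds_metric
  proof (intro exI[of _ e] conjI allI impI e)
    fix v :: real assume "dist v t < e"
    then have "\<bar>v - t\<bar> \<le> e" by (simp add: dist_real_def)
    then have "\<bar>v - t\<bar> * \<bar>fst d\<bar> \<le> s" "\<bar>v - t\<bar> * \<bar>snd d\<bar> \<le> s"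
      using es by (meson abs_ge_zero mult_right_mono order_trans)+
    then have "\<bar>(v - t) * fst d\<bar> < r" "\<bar>(v - t) * snd d\<bar> < r"
      using s by (auto simp: abs_mult)
    from complex_series_of_real[OF u this]
    show "complex_series c (?h (of_real v)) = of_real (u (z + v *\<^sub>R d))"
      by (cases z; cases d) (simp add: algebra_simps)
  qed
  ultimately show "real_analytic_at (\<lambda>s. u (z + s *\<^sub>R d)) t"
    unfolding real_analytic_at_def by blast
qed

text \<open>Inside a ball of \<open>D\<close>, which is convex, every point is joined by a segment
  to a point near which \<open>f\<close> vanishes, and the one-dimensional theorem applies on that
  segment.\<close>

lemma analytic_along_lines_identity:
  assumes D: "open D" "connected D" and f: "analytic_along_lines D f"
    and U: "open U" "U \<noteq> {}" "U \<subseteq> D" "\<And>z. z \<in> U \<Longrightarrow> f z = 0"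
    and "z \<in> D"
  shows "f z = 0"
proof -
  obtain x where x: "x \<in> U" using U by blast
  have "\<forall>\<^sub>F w in nhds z. f w = 0"
  proof (rule eventually_nhds_connected[OF \<open>connected D\<close>, of x])
    show "x \<in> D" using x U by blast
    show "\<forall>\<^sub>F w in nhds x. f w = 0" using x U unfolding eventually_nhds by blast
    fix z assume z: "z \<in> D" and cl: "z \<in> closure {w. \<forall>\<^sub>F s in nhds w. f s = 0}"
    obtain e where e: "0 < e" "ball z e \<subseteq> D" using D z open_contains_ball by blast
    obtain y where y: "\<forall>\<^sub>F s in nhds y. f s = 0" "y \<in> ball z e"
      using cl e unfolding closure_approachable by (auto simp: dist_commute)
    have "f w = 0" if w: "w \<in> ball z e" for w
    proof -
      have "f (y + 1 *\<^sub>R (w - y)) = 0"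
      proof (rule real_analytic_identity[of "{0..1}" "\<lambda>t. f (y + t *\<^sub>R (w - y))" 0])
        fix t :: real assume t: "t \<in> {0..1}"
        have "y + t *\<^sub>R (w - y) = (1 - t) *\<^sub>R y + t *\<^sub>R w"
          by (simp add: algebra_simps)
        also have "\<dots> \<in> ball z e"
          using convex_ball[of z e] y w t unfolding convex_alt by auto
        finally show "real_analytic_at (\<lambda>t. f (y + t *\<^sub>R (w - y))) t"
          using f e unfolding analytic_along_lines_def by blast
      next
        have "isCont (\<lambda>t. y + t *\<^sub>R (w - y)) 0" by (intro continuous_intros)
        then have "filterlim (\<lambda>t. y + t *\<^sub>R (w - y)) (nhds y) (nhds 0)"
          using tendsto_at_iff_tendsto_nhds[of "\<lambda>t. y + t *\<^sub>R (w - y)" 0] by (simp add: isCont_def)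
        then show "\<forall>\<^sub>F t in nhds 0. f (y + t *\<^sub>R (w - y)) = 0"
          using y(1) by (rule eventually_compose_filterlim[rotated])
      qed auto
      then show ?thesis by simp
    qed
    then show "\<forall>\<^sub>F w in nhds z. f w = 0"
      using e unfolding eventually_nhds by (intro exI[of _ "ball z e"]) auto
  qed (use \<open>z \<in> D\<close> in auto)
  then show ?thesis by (rule eventually_nhds_x_imp_x)
qed

section \<open>Derivatives and smoothness\<close>

lemma real_analytic_on_has_partial_derivatives:
  assumes "real_analytic_on D u" "(a, b) \<in> D"
  shows "((\<lambda>t. u (t, b)) has_real_derivative partial_x u (a, b)) (at a)"
    and "((\<lambda>t. u (a, t)) has_real_derivative partial_y u (a, b)) (at b)"
proof -
  obtain c r where u: "has_power_series_at u c r (a, b)"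
    using assms unfolding real_analytic_on_iff by blast
  then have r: "0 < r" by (simp add: has_power_series_at_def)
  show "((\<lambda>t. u (t, b)) has_real_derivative partial_x u (a, b)) (at a)"
    using has_power_series_at_has_partial_x(1)[OF u, of 0 0] r
      DERIV_shift[of "\<lambda>t. u (t, b)" "partial_x u (a, b)" 0 a]
    by (simp add: add.commute)
  show "((\<lambda>t. u (a, t)) has_real_derivative partial_y u (a, b)) (at b)"
    using has_power_series_at_has_partial_x(1)[OF has_power_series_at_swap[OF u], of 0 0] r
      DERIV_shift[of "\<lambda>t. u (a, t)" "partial_y u (a, b)" 0 b]
    by (simp add: add.commute partial_y_conv_partial_x)
qed

text \<open>Continuity of the second partial derivative turns partial differentiability into Frechet
  differentiability. The criterion wants a convex second factor, hence the ball about
  \<open>b\<close>.\<close>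

lemma real_analytic_on_has_derivative:
  assumes u: "real_analytic_on D u" and D: "open D" and z: "z \<in> D"
  shows "(u has_derivative (\<lambda>h. partial_x u z * fst h + partial_y u z * snd h)) (at z)"
proof -
  obtain a b where ab: "z = (a, b)" by (cases z)
  obtain X Y where XY: "open X" "open Y" "z \<in> X \<times> Y" "X \<times> Y \<subseteq> D"
    using open_prod_elim[OF D z] by blast
  obtain e where e: "0 < e" "ball b e \<subseteq> Y" 
    using XY ab open_contains_ball[of Y] by auto
  let ?fy = "\<lambda>x y. blinfun_mult_right (partial_y u (x, y))"
  have "((\<lambda>(x, y). u (x, y)) has_derivative
      (\<lambda>(tx, ty). partial_x u (a, b) * tx + blinfun_apply (?fy a b) ty)) (at (a, b) within X \<times> ball b e)"
  proof (rule has_derivative_partialsI)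
    show "((\<lambda>x. u (x, b)) has_derivative (*) (partial_x u (a, b))) (at a within X)"
      by (rule has_derivative_at_withinI[OF real_analytic_on_has_partial_derivatives(1)
            [OF u z[unfolded ab], unfolded has_field_derivative_def]])
    fix x y assume "x \<in> X" "y \<in> ball b e"
    then have "(x, y) \<in> D" using XY e by blast
    then show "((\<lambda>y. u (x, y)) has_derivative blinfun_apply (?fy x y)) (at y within ball b e)"
      unfolding blinfun_mult_right.rep_eq
      by (rule has_derivative_at_withinI[OF real_analytic_on_has_partial_derivatives(2)
            [OF u, unfolded has_field_derivative_def]])
  next
    have "isCont (partial_y u) (a, b)"
      using real_analytic_on_imp_isCont[OF real_analytic_on_partial_y[OF u] z] by (simp add: ab)
    then have "isCont (\<lambda>z. blinfun_mult_right (partial_y u z)) (a, b)"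
      by (intro bounded_linear.isCont[OF bounded_linear_blinfun_mult_right])
    from continuous_at_imp_continuous_at_within[OF this]
    show "continuous (at (a, b) within X \<times> ball b e) (\<lambda>(x, y). ?fy x y)"
      by (simp add: case_prod_beta')
  qed (use e in auto)
  moreover have "(a, b) \<in> X \<times> ball b e" "open (X \<times> ball b e)"
    using XY e ab by (auto intro: open_Times)
  moreover have "(\<lambda>(x, y). u (x, y)) = u"
    and "(\<lambda>(tx, ty). partial_x u (a, b) * tx + blinfun_apply (?fy a b) ty) =
      (\<lambda>h. partial_x u z * fst h + partial_y u z * snd h)"
    by (auto simp: ab)
  ultimately show ?thesis
    unfolding ab by (simp only: at_within_open)
qed

lemma real_analytic_on_has_derivative_along:
  assumes "real_analytic_on D u" "open D" "g t \<in> D" and g: "(g has_vector_derivative g') (at t)"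
  shows "((\<lambda>s. u (g s)) has_real_derivative
    (partial_x u (g t) * fst g' + partial_y u (g t) * snd g')) (at t)"
  unfolding has_field_derivative_def
  by (rule has_derivative_eq_rhs[OF has_derivative_compose[OF g[unfolded has_vector_derivative_def]
      real_analytic_on_has_derivative[OF assms(1-3)]]]) (auto simp: algebra_simps)

lemma partial_cong:
  assumes "open D" "z \<in> D" "\<And>w. w \<in> D \<Longrightarrow> f w = g w"
  shows "partial_x f z = partial_x g z" "partial_y f z = partial_y g z"
proof -
  obtain a b where ab: "z = (a, b)" by (cases z)
  obtain X Y where XY: "open X" "open Y" "z \<in> X \<times> Y" "X \<times> Y \<subseteq> D"
    using open_prod_elim[OF assms(1,2)] by blast
  have "\<forall>\<^sub>F t in nhds a. f (t, b) = g (t, b)" "\<forall>\<^sub>F t in nhds b. f (a, t) = g (a, t)"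
    unfolding eventually_nhds using XY assms(3) ab by blast+
  then show "partial_x f z = partial_x g z" "partial_y f z = partial_y g z"
    unfolding partial_x_def partial_y_def ab by (auto intro!: deriv_cong_ev)
qed

lemma C2_on_real_analytic:
  assumes u: "real_analytic_on D u" and D: "open D"
  shows "C2_on D u"
proof -
  let ?ux = "partial_x u" and ?uy = "partial_y u"
  note ux = real_analytic_on_partial_x[OF u] and uy = real_analytic_on_partial_y[OF u]
  note sec = real_analytic_on_partial_x[OF ux] real_analytic_on_partial_y[OF ux]
    real_analytic_on_partial_x[OF uy] real_analytic_on_partial_y[OF uy]
  let ?f = "fst_blinfun :: (real \<times> real) \<Rightarrow>\<^sub>L real" and ?s = "snd_blinfun :: (real \<times> real) \<Rightarrow>\<^sub>L real"
  define u' where "u' z = ?ux z *\<^sub>R ?f + ?uy z *\<^sub>R ?s" for z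
  \<comment> \<open>Each composition is a rank-one map, for instance \<open>h\<close> goes to
    \<open>snd h *\<^sub>R ?f\<close>; the four coefficients are the entries of the Hessian.\<close>
  define u'' where "u'' z =
      partial_x ?ux z *\<^sub>R (blinfun_scaleR_left ?f o\<^sub>L ?f) + partial_y ?ux z *\<^sub>R (blinfun_scaleR_left ?f o\<^sub>L ?s)
    + (partial_x ?uy z *\<^sub>R (blinfun_scaleR_left ?s o\<^sub>L ?f) + partial_y ?uy z *\<^sub>R (blinfun_scaleR_left ?s o\<^sub>L ?s))" for z
  have "(u has_derivative blinfun_apply (u' z)) (at z)" if "z \<in> D" for z
    by (rule has_derivative_eq_rhs[OF real_analytic_on_has_derivative[OF u D that]])
       (simp add: u'_def fun_eq_iff blinfun.bilinear_simps fst_blinfun.rep_eq snd_blinfun.rep_eq)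
  moreover have "(u' has_derivative blinfun_apply (u'' z)) (at z)" if "z \<in> D" for z
    unfolding u'_def
    using real_analytic_on_has_derivative[OF ux D that] real_analytic_on_has_derivative[OF uy D that]
    by (auto intro!: derivative_eq_intros
        simp: u''_def blinfun.bilinear_simps fst_blinfun.rep_eq snd_blinfun.rep_eq algebra_simps)
  moreover have "continuous_on D u''"
    unfolding u''_def using sec[THEN real_analytic_on_imp_isCont]
    by (intro continuous_intros) (auto simp: continuous_on_eq_continuous_at[OF D])
  ultimately show ?thesis
    unfolding C2_on_def by blast
qed

lemma C2_on_UNIV_real:
  fixes f f' f'' :: "real \<Rightarrow> real"
  assumes "\<And>x. (f has_real_derivative f' x) (at x)" "\<And>x. (f' has_real_derivative f'' x) (at x)"
    and "continuous_on UNIV f''"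
  shows "C2_on UNIV f"
  unfolding C2_on_def
proof (intro exI conjI ballI)
  fix x
  show "(f has_derivative blinfun_apply (blinfun_mult_right (f' x))) (at x)"
    using assms(1)[of x] by (simp add: has_field_derivative_def blinfun_mult_right.rep_eq)
  show "((\<lambda>x. blinfun_mult_right (f' x)) has_derivative
      blinfun_apply (f'' x *\<^sub>R blinfun_scaleR_left (blinfun_mult_right 1))) (at x)"
  proof -
    have "(\<lambda>h. blinfun_mult_right (f'' x * h)) =
        blinfun_apply (f'' x *\<^sub>R blinfun_scaleR_left (blinfun_mult_right 1))"
      by (auto simp: fun_eq_iff blinfun_eqI blinfun.bilinear_simps blinfun_mult_right.rep_eq intro!: blinfun_eqI)
    then show ?thesis
      using bounded_linear.has_derivative[OF bounded_linear_blinfun_mult_right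
          assms(2)[of x, unfolded has_field_derivative_def]] by simp
  qed
  show "continuous_on UNIV (\<lambda>x. f'' x *\<^sub>R blinfun_scaleR_left (blinfun_mult_right (1::real)))"
    using assms(3) by (intro continuous_intros)
qed

section \<open>Degenerate Hessians along lines\<close>

text \<open>A Gronwall argument: for \<open>t\<close> at least 0 the square of \<open>f\<close>
  times \<open>exp (- 2 * M * t)\<close> is nonincreasing, nonnegative and 0 at the start. For
  negative \<open>t\<close> the sign of the exponent is reversed.\<close>

lemma linear_ode_zero:
  fixes f B :: "real \<Rightarrow> real"
  assumes f: "\<And>t. \<bar>t\<bar> < e \<Longrightarrow> (f has_real_derivative f t * B t) (at t)"
    and B: "\<And>t. \<bar>t\<bar> < e \<Longrightarrow> \<bar>B t\<bar> \<le> M" and "f 0 = 0" and t: "\<bar>t\<bar> < e"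
  shows "f t = 0"
proof (cases "0 \<le> t")
  case True
  have "(f t)\<^sup>2 * exp (- 2 * M * t) \<le> (f 0)\<^sup>2 * exp (- 2 * M * 0)"
  proof (rule DERIV_nonpos_imp_nonincreasing[OF True])
    fix s assume "0 \<le> s" "s \<le> t"
    then have s: "\<bar>s\<bar> < e" using t by auto
    have "((\<lambda>t. (f t)\<^sup>2 * exp (- 2 * M * t)) has_real_derivative
        2 * (f s)\<^sup>2 * exp (- 2 * M * s) * (B s - M)) (at s)"
      by (auto intro!: derivative_eq_intros f[OF s] simp: power2_eq_square algebra_simps)
    moreover have "2 * (f s)\<^sup>2 * exp (- 2 * M * s) * (B s - M) \<le> 0"
      using B[OF s] by (intro mult_nonneg_nonpos) auto
    ultimately show "\<exists>y. ((\<lambda>t. (f t)\<^sup>2 * exp (- 2 * M * t)) has_real_derivative y) (at s) \<and> y \<le> 0"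
      by blast
  qed
  then show ?thesis using \<open>f 0 = 0\<close> by (simp add: mult_le_0_iff)
next
  case False
  then have t0: "t \<le> 0" by simp
  have "(f t)\<^sup>2 * exp (2 * M * t) \<le> (f 0)\<^sup>2 * exp (2 * M * 0)"
  proof (rule DERIV_nonneg_imp_nondecreasing[OF t0])
    fix s assume "t \<le> s" "s \<le> 0"
    then have s: "\<bar>s\<bar> < e" using t by auto
    have "((\<lambda>t. (f t)\<^sup>2 * exp (2 * M * t)) has_real_derivative
        2 * (f s)\<^sup>2 * exp (2 * M * s) * (B s + M)) (at s)"
      by (auto intro!: derivative_eq_intros f[OF s] simp: power2_eq_square algebra_simps)
    moreover have "0 \<le> 2 * (f s)\<^sup>2 * exp (2 * M * s) * (B s + M)"
      using B[OF s] by (intro mult_nonneg_nonneg) auto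
    ultimately show "\<exists>y. ((\<lambda>t. (f t)\<^sup>2 * exp (2 * M * t)) has_real_derivative y) (at s) \<and> 0 \<le> y"
      by blast
  qed
  then show ?thesis using \<open>f 0 = 0\<close> by (simp add: mult_le_0_iff)
qed

text \<open>
  Here \<^term>\<open>a\<close>, \<^term>\<open>b\<close>, \<^term>\<open>c\<close> are the entries of a degenerate Hessian along a line with
  direction \<^term>\<open>(p, q)\<close>. By the symmetry of third derivatives and the derivative of
  \<^term>\<open>a * c = b\<^sup>2\<close> across the line, \<^term>\<open>p * b + q * c\<close> solves a homogeneous linear equation.
\<close>

lemma degenerate_kernel_ode:
  fixes a b c a\<^sub>y b\<^sub>y c\<^sub>y :: "real \<Rightarrow> real"
  assumes ev: "\<forall>\<^sub>F t in nhds 0. (b has_real_derivative p * a\<^sub>y t + q * b\<^sub>y t) (at t) \<and>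
      (c has_real_derivative p * b\<^sub>y t + q * c\<^sub>y t) (at t) \<and>
      a t * c t = (b t)\<^sup>2 \<and> a\<^sub>y t * c t + a t * c\<^sub>y t = 2 * b t * b\<^sub>y t"
    and cont: "isCont b\<^sub>y 0" "isCont c\<^sub>y 0"
    and c0: "c 0 \<noteq> 0" and k0: "p * b 0 + q * c 0 = 0"
  shows "\<forall>\<^sub>F t in nhds 0. p * a t + q * b t = 0 \<and> p * b t + q * c t = 0"
proof -
  \<comment> \<open>\<open>B\<close> is the factor in \<open>g' = g * B\<close>. Inserting
    \<open>a = b^2 / c\<close> and the resulting value of \<open>a\<^sub>y\<close> into the
    derivative of \<open>g\<close>, what remains besides a multiple of \<open>g\<close> contains
    \<open>q^2 * c^2 - p^2 * b^2 = (q * c - p * b) * g\<close>. Degeneracy also makes the first row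
    of the Hessian \<open>b / c\<close> times the second, so \<open>g = 0\<close> yields both kernel
    equations.\<close>
  define B where "B t = 2 * p * b\<^sub>y t / c t + c\<^sub>y t * (q * c t - p * b t) / (c t)\<^sup>2" for t
  define g where "g t = p * b t + q * c t" for t
  have bc: "isCont b 0" "isCont c 0"
    using eventually_nhds_x_imp_x[OF ev] by (auto intro: DERIV_isCont)
  then have "isCont B 0"
    unfolding B_def using cont c0 by (intro continuous_intros) auto
  then have "(B \<longlongrightarrow> B 0) (nhds 0)"
    unfolding isCont_def using tendsto_at_iff_tendsto_nhds by blast
  then have "\<forall>\<^sub>F t in nhds 0. dist (B t) (B 0) < 1"
    by (rule tendstoD) simp
  moreover have "\<forall>\<^sub>F t in nhds 0. c t \<noteq> 0"
    using bc(2) c0 unfolding isCont_def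
    by (metis tendsto_at_iff_tendsto_nhds tendsto_imp_eventually_ne)
  ultimately have "\<forall>\<^sub>F t in nhds 0. c t \<noteq> 0 \<and> \<bar>B t\<bar> \<le> \<bar>B 0\<bar> + 1 \<and>
      (g has_real_derivative g t * B t) (at t) \<and> p * a t + q * b t = b t / c t * g t"
    using ev
  proof eventually_elim
    case (elim t)
    then have c: "c t \<noteq> 0" by simp
    have a: "a t = (b t)\<^sup>2 / c t" using elim c by (simp add: field_simps)
    have a\<^sub>y: "a\<^sub>y t = (2 * b t * b\<^sub>y t - a t * c\<^sub>y t) / c t"
      using elim c by (simp add: field_simps)
    have "p * (p * a\<^sub>y t + q * b\<^sub>y t) + q * (p * b\<^sub>y t + q * c\<^sub>y t) = g t * B t"
      and "p * a t + q * b t = b t / c t * g t"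
      unfolding a\<^sub>y a g_def B_def using c by (simp_all add: field_simps power2_eq_square)
    moreover have "(g has_real_derivative p * (p * a\<^sub>y t + q * b\<^sub>y t) + q * (p * b\<^sub>y t + q * c\<^sub>y t)) (at t)"
      unfolding g_def using elim by (auto intro!: derivative_eq_intros)
    ultimately show ?case using c elim by (auto simp: dist_real_def)
  qed
  then obtain e where e: "0 < e" "\<And>t. \<bar>t\<bar> < e \<Longrightarrow> \<bar>B t\<bar> \<le> \<bar>B 0\<bar> + 1"
      "\<And>t. \<bar>t\<bar> < e \<Longrightarrow> (g has_real_derivative g t * B t) (at t)"
      "\<And>t. \<bar>t\<bar> < e \<Longrightarrow> p * a t + q * b t = b t / c t * g t"
    unfolding eventually_nhds_metric by (auto simp: dist_real_def)
  have "g t = 0" if "\<bar>t\<bar> < e" for t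
    by (rule linear_ode_zero[OF e(3,2) _ that]) (use k0 in \<open>auto simp: g_def\<close>)
  with e show ?thesis
    unfolding eventually_nhds_metric by (intro exI[of _ e]) (auto simp: dist_real_def g_def)
qed

section \<open>Auxiliary topology and plane geometry\<close>

text \<open>By induction, each \<open>W i\<close> meets the nonempty open set obtained so far. It
  will provide points whose kernel lines miss all of the finite singular set.\<close>

lemma finite_Int_open_dense:
  assumes "finite I" "open U" "U \<noteq> {}"
    and W: "\<And>i. i \<in> I \<Longrightarrow> open (W i)"
    and dense: "\<And>i V. i \<in> I \<Longrightarrow> open V \<Longrightarrow> V \<noteq> {} \<Longrightarrow> V \<subseteq> U \<Longrightarrow> W i \<inter> V \<noteq> {}"
  shows "open (U \<inter> (\<Inter>i\<in>I. W i)) \<and> U \<inter> (\<Inter>i\<in>I. W i) \<noteq> {}"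
  using assms(1) W dense
proof (induction I rule: finite_induct)
  case empty
  then show ?case using assms by simp
next
  case (insert i I)
  then have IH: "open (U \<inter> (\<Inter>i\<in>I. W i))" "U \<inter> (\<Inter>i\<in>I. W i) \<noteq> {}"
    by auto
  have eq: "U \<inter> (\<Inter>j\<in>insert i I. W j) = W i \<inter> (U \<inter> (\<Inter>i\<in>I. W i))"
    by auto
  show ?case
    unfolding eq using insert.prems(1)[of i] insert.prems(2)[of i "U \<inter> (\<Inter>i\<in>I. W i)"] IH
    by (auto intro: open_Int)
qed

lemma lines_intersect:
  fixes z w v d :: "real \<times> real"
  assumes "fst v * snd d \<noteq> snd v * fst d"
  obtains s t where "z + s *\<^sub>R v = w + t *\<^sub>R d"
proof -
  \<comment> \<open>Cramer's rule for the two unknown parameters; \<open>?D\<close> is the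
    determinant of the directions.\<close>
  let ?D = "fst v * snd d - snd v * fst d"
  let ?s = "((fst w - fst z) * snd d - (snd w - snd z) * fst d) / ?D"
  let ?t = "((fst w - fst z) * snd v - (snd w - snd z) * fst v) / ?D"
  have "z + ?s *\<^sub>R v = w + ?t *\<^sub>R d"
    using assms by (intro prod_eqI) (simp_all add: field_simps)
  then show thesis by (rule that)
qed

section \<open>Solutions of the degenerate Monge-Ampere equation off a finite set\<close>

locale developable =
  fixes F :: "(real \<times> real) set" and u :: "real \<times> real \<Rightarrow> real"
  assumes finite_F: "finite F"
    and analytic: "real_analytic_on (- F) u"
    and hessian_det: "\<And>z. z \<notin> F \<Longrightarrow>
      partial_x (partial_x u) z * partial_y (partial_y u) z = (partial_y (partial_x u) z)\<^sup>2"
begin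

abbreviation "u\<^sub>x \<equiv> partial_x u"
abbreviation "u\<^sub>y \<equiv> partial_y u"
abbreviation "u\<^sub>x\<^sub>x \<equiv> partial_x (partial_x u)"
abbreviation "u\<^sub>x\<^sub>y \<equiv> partial_y (partial_x u)"
abbreviation "u\<^sub>y\<^sub>y \<equiv> partial_y (partial_y u)"

lemma open_domain: "open (- F)"
  using finite_F by (simp add: finite_imp_closed open_Compl)

lemma connected_domain: "connected (- F)"
  using connected_open_diff_countable[of UNIV F] finite_F
  by (simp add: Compl_eq_Diff_UNIV countable_finite convex_connected)

lemmas analytic_first =
  real_analytic_on_partial_x[OF analytic] real_analytic_on_partial_y[OF analytic]

lemmas analytic_second =
  real_analytic_on_partial_x[OF analytic_first(1)] real_analytic_on_partial_y[OF analytic_first(1)]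
  real_analytic_on_partial_y[OF analytic_first(2)]

lemma partial_x_u\<^sub>y: "z \<notin> F \<Longrightarrow> partial_x u\<^sub>y z = u\<^sub>x\<^sub>y z"
  using real_analytic_on_partial_commute[OF analytic] by simp

lemma third_commute:
  assumes "z \<notin> F"
  shows "partial_x u\<^sub>x\<^sub>y z = partial_y u\<^sub>x\<^sub>x z" "partial_x u\<^sub>y\<^sub>y z = partial_y u\<^sub>x\<^sub>y z"
proof -
  show "partial_x u\<^sub>x\<^sub>y z = partial_y u\<^sub>x\<^sub>x z"
    using real_analytic_on_partial_commute[OF analytic_first(1)] assms by simp
  have "partial_x u\<^sub>y\<^sub>y z = partial_y (partial_x u\<^sub>y) z"
    using real_analytic_on_partial_commute[OF analytic_first(2)] assms by simp
  also have "\<dots> = partial_y u\<^sub>x\<^sub>y z"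
    by (rule partial_cong(2)[OF open_domain]) (use assms partial_x_u\<^sub>y in auto)
  finally show "partial_x u\<^sub>y\<^sub>y z = partial_y u\<^sub>x\<^sub>y z" .
qed

lemma DERIV_along_line:
  assumes "real_analytic_on (- F) f" "z + t *\<^sub>R v \<notin> F"
  shows "((\<lambda>s. f (z + s *\<^sub>R v)) has_real_derivative
    (fst v * partial_x f (z + t *\<^sub>R v) + snd v * partial_y f (z + t *\<^sub>R v))) (at t)"
proof -
  have "((\<lambda>s. z + s *\<^sub>R v) has_vector_derivative v) (at t)"
    by (auto intro!: derivative_eq_intros)
  from real_analytic_on_has_derivative_along[OF assms(1) open_domain _ this] assms(2)
  show ?thesis by (simp add: mult.commute)
qed

text \<open>The determinant vanishes identically on an open set, hence so does its derivative in
  each direction; the coordinate directions give the two identities.\<close>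

lemma hessian_det_derivative:
  assumes z: "z \<notin> F"
  shows "partial_x u\<^sub>x\<^sub>x z * u\<^sub>y\<^sub>y z + u\<^sub>x\<^sub>x z * partial_x u\<^sub>y\<^sub>y z = 2 * u\<^sub>x\<^sub>y z * partial_x u\<^sub>x\<^sub>y z"
    and "partial_y u\<^sub>x\<^sub>x z * u\<^sub>y\<^sub>y z + u\<^sub>x\<^sub>x z * partial_y u\<^sub>y\<^sub>y z = 2 * u\<^sub>x\<^sub>y z * partial_y u\<^sub>x\<^sub>y z"
proof -
  have *: "(fst v * partial_x u\<^sub>x\<^sub>x z + snd v * partial_y u\<^sub>x\<^sub>x z) * u\<^sub>y\<^sub>y z +
      (fst v * partial_x u\<^sub>y\<^sub>y z + snd v * partial_y u\<^sub>y\<^sub>y z) * u\<^sub>x\<^sub>x z =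
      2 * u\<^sub>x\<^sub>y z * (fst v * partial_x u\<^sub>x\<^sub>y z + snd v * partial_y u\<^sub>x\<^sub>y z)" for v
  proof -
    let ?l = "\<lambda>s. z + s *\<^sub>R v"
    have "((\<lambda>s. u\<^sub>x\<^sub>x (?l s) * u\<^sub>y\<^sub>y (?l s) - (u\<^sub>x\<^sub>y (?l s))\<^sup>2) has_real_derivative
      ((fst v * partial_x u\<^sub>x\<^sub>x z + snd v * partial_y u\<^sub>x\<^sub>x z) * u\<^sub>y\<^sub>y z +
      (fst v * partial_x u\<^sub>y\<^sub>y z + snd v * partial_y u\<^sub>y\<^sub>y z) * u\<^sub>x\<^sub>x z -
      2 * u\<^sub>x\<^sub>y z * (fst v * partial_x u\<^sub>x\<^sub>y z + snd v * partial_y u\<^sub>x\<^sub>y z))) (at 0)"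
      using analytic_second[THEN DERIV_along_line, of z 0 v] z
      by (auto intro!: derivative_eq_intros)
    moreover have "open (?l -` (- F))"
      by (intro open_vimage open_domain continuous_intros)
    then have "((\<lambda>s. u\<^sub>x\<^sub>x (?l s) * u\<^sub>y\<^sub>y (?l s) - (u\<^sub>x\<^sub>y (?l s))\<^sup>2) has_real_derivative 0) (at 0)"
      by (intro has_field_derivative_transform_within_open[OF DERIV_const])
         (use z hessian_det in auto)
    ultimately show ?thesis
      using DERIV_unique by fastforce
  qed
  show "partial_x u\<^sub>x\<^sub>x z * u\<^sub>y\<^sub>y z + u\<^sub>x\<^sub>x z * partial_x u\<^sub>y\<^sub>y z = 2 * u\<^sub>x\<^sub>y z * partial_x u\<^sub>x\<^sub>y z"
    using *[of "(1, 0)"] by (simp add: mult.commute)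
  show "partial_y u\<^sub>x\<^sub>x z * u\<^sub>y\<^sub>y z + u\<^sub>x\<^sub>x z * partial_y u\<^sub>y\<^sub>y z = 2 * u\<^sub>x\<^sub>y z * partial_y u\<^sub>x\<^sub>y z"
    using *[of "(0, 1)"] by (simp add: mult.commute)
qed

definition kernel :: "real \<times> real \<Rightarrow> real \<times> real \<Rightarrow> bool" where
  "kernel z v \<longleftrightarrow> fst v * u\<^sub>x\<^sub>x z + snd v * u\<^sub>x\<^sub>y z = 0 \<and> fst v * u\<^sub>x\<^sub>y z + snd v * u\<^sub>y\<^sub>y z = 0"

lemma isCont_along_line:
  assumes "real_analytic_on (- F) f" "z \<notin> F"
  shows "isCont (\<lambda>t. f (z + t *\<^sub>R v)) 0"
  using DERIV_isCont[OF DERIV_along_line[OF assms(1), of z 0 v]] assms(2) by simp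

text \<open>This is the straightness of the integral curves of the kernel field. Since the square of
  \<open>u\<^sub>x\<^sub>y\<close> is the product of the diagonal entries, a nonzero Hessian has a
  nonzero diagonal entry, which serves as the coefficient \<open>c\<close> in
  \<open>degenerate_kernel_ode\<close>.\<close>

lemma kernel_near:
  assumes z: "z \<notin> F" and nz: "u\<^sub>x\<^sub>x z \<noteq> 0 \<or> u\<^sub>y\<^sub>y z \<noteq> 0" and v: "kernel z v"
  shows "\<forall>\<^sub>F t in nhds 0. kernel (z + t *\<^sub>R v) v"
proof -
  let ?l = "\<lambda>s. z + s *\<^sub>R v"
  have "open (?l -` (- F))"
    by (intro open_vimage open_domain continuous_intros)
  then have ev: "\<forall>\<^sub>F t in nhds 0. ?l t \<notin> F"
    unfolding eventually_nhds using z by (intro exI[of _ "?l -` (- F)"]) auto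
  show ?thesis
  proof (cases "u\<^sub>y\<^sub>y z = 0")
    case False
    have "\<forall>\<^sub>F t in nhds 0. fst v * u\<^sub>x\<^sub>x (?l t) + snd v * u\<^sub>x\<^sub>y (?l t) = 0 \<and>
        fst v * u\<^sub>x\<^sub>y (?l t) + snd v * u\<^sub>y\<^sub>y (?l t) = 0"
    proof (rule degenerate_kernel_ode[where a\<^sub>y = "\<lambda>t. partial_y u\<^sub>x\<^sub>x (?l t)"
          and b\<^sub>y = "\<lambda>t. partial_y u\<^sub>x\<^sub>y (?l t)" and c\<^sub>y = "\<lambda>t. partial_y u\<^sub>y\<^sub>y (?l t)"])
      show "\<forall>\<^sub>F t in nhds 0.
          ((\<lambda>t. u\<^sub>x\<^sub>y (?l t)) has_real_derivative
            fst v * partial_y u\<^sub>x\<^sub>x (?l t) + snd v * partial_y u\<^sub>x\<^sub>y (?l t)) (at t) \<and>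
          ((\<lambda>t. u\<^sub>y\<^sub>y (?l t)) has_real_derivative
            fst v * partial_y u\<^sub>x\<^sub>y (?l t) + snd v * partial_y u\<^sub>y\<^sub>y (?l t)) (at t) \<and>
          u\<^sub>x\<^sub>x (?l t) * u\<^sub>y\<^sub>y (?l t) = (u\<^sub>x\<^sub>y (?l t))\<^sup>2 \<and>
          partial_y u\<^sub>x\<^sub>x (?l t) * u\<^sub>y\<^sub>y (?l t) + u\<^sub>x\<^sub>x (?l t) * partial_y u\<^sub>y\<^sub>y (?l t) =
          2 * u\<^sub>x\<^sub>y (?l t) * partial_y u\<^sub>x\<^sub>y (?l t)"
        using ev
      proof eventually_elim
        case (elim t)
        show ?case
          using DERIV_along_line[OF analytic_second(2) elim] DERIV_along_line[OF analytic_second(3) elim]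
            third_commute[OF elim] hessian_det[OF elim] hessian_det_derivative(2)[OF elim]
          by simp
      qed
    qed (use False v z isCont_along_line[OF real_analytic_on_partial_y] analytic_second
        in \<open>auto simp: kernel_def\<close>)
    then show ?thesis by (simp add: kernel_def)
  next
    \<comment> \<open>Now \<open>u\<^sub>x\<^sub>x\<close> is the nonzero entry, and the same lemma
      is applied with the two coordinates exchanged.\<close>
    case True
    have "\<forall>\<^sub>F t in nhds 0. snd v * u\<^sub>y\<^sub>y (?l t) + fst v * u\<^sub>x\<^sub>y (?l t) = 0 \<and>
        snd v * u\<^sub>x\<^sub>y (?l t) + fst v * u\<^sub>x\<^sub>x (?l t) = 0"
    proof (rule degenerate_kernel_ode[where a\<^sub>y = "\<lambda>t. partial_x u\<^sub>y\<^sub>y (?l t)"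
          and b\<^sub>y = "\<lambda>t. partial_x u\<^sub>x\<^sub>y (?l t)" and c\<^sub>y = "\<lambda>t. partial_x u\<^sub>x\<^sub>x (?l t)"])
      show "\<forall>\<^sub>F t in nhds 0.
          ((\<lambda>t. u\<^sub>x\<^sub>y (?l t)) has_real_derivative
            snd v * partial_x u\<^sub>y\<^sub>y (?l t) + fst v * partial_x u\<^sub>x\<^sub>y (?l t)) (at t) \<and>
          ((\<lambda>t. u\<^sub>x\<^sub>x (?l t)) has_real_derivative
            snd v * partial_x u\<^sub>x\<^sub>y (?l t) + fst v * partial_x u\<^sub>x\<^sub>x (?l t)) (at t) \<and>
          u\<^sub>y\<^sub>y (?l t) * u\<^sub>x\<^sub>x (?l t) = (u\<^sub>x\<^sub>y (?l t))\<^sup>2 \<and>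
          partial_x u\<^sub>y\<^sub>y (?l t) * u\<^sub>x\<^sub>x (?l t) + u\<^sub>y\<^sub>y (?l t) * partial_x u\<^sub>x\<^sub>x (?l t) =
          2 * u\<^sub>x\<^sub>y (?l t) * partial_x u\<^sub>x\<^sub>y (?l t)"
        using ev
      proof eventually_elim
        case (elim t)
        show ?case
          using DERIV_along_line[OF analytic_second(2) elim] DERIV_along_line[OF analytic_second(1) elim]
            third_commute[OF elim] hessian_det[OF elim] hessian_det_derivative(1)[OF elim]
          by (simp add: algebra_simps)
      qed
    qed (use True nz v z isCont_along_line[OF real_analytic_on_partial_x] analytic_second
        in \<open>auto simp: kernel_def\<close>)
    then show ?thesis by (simp add: kernel_def add.commute conj_commute)
  qed
qed

lemma analytic_along_lines_second:
  "analytic_along_lines (- F) u\<^sub>x\<^sub>x" "analytic_along_lines (- F) u\<^sub>x\<^sub>y" "analytic_along_lines (- F) u\<^sub>y\<^sub>y"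
  using analytic_second by (auto intro: real_analytic_on_imp_analytic_along_lines)

text \<open>The kernel equations hold near \<open>z\<close> and spread over the whole line by the
  one-dimensional identity theorem, even past points where the Hessian vanishes. The derivative of
  the gradient along the line is the Hessian applied to \<open>v\<close>.\<close>

lemma gradient_constant_on_kernel_line:
  assumes z: "z \<notin> F" and nz: "u\<^sub>x\<^sub>x z \<noteq> 0 \<or> u\<^sub>y\<^sub>y z \<noteq> 0" and v: "kernel z v"
    and line: "\<And>t. z + t *\<^sub>R v \<notin> F"
  shows "u\<^sub>x (z + t *\<^sub>R v) = u\<^sub>x z" "u\<^sub>y (z + t *\<^sub>R v) = u\<^sub>y z"
proof -
  let ?l = "\<lambda>s. z + s *\<^sub>R v"
  note near = kernel_near[OF z nz v, unfolded kernel_def]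
  have an: "real_analytic_at (\<lambda>s. u\<^sub>x\<^sub>x (?l s)) t" "real_analytic_at (\<lambda>s. u\<^sub>x\<^sub>y (?l s)) t"
    "real_analytic_at (\<lambda>s. u\<^sub>y\<^sub>y (?l s)) t" for t
    using analytic_along_lines_second line unfolding analytic_along_lines_def by blast+
  have "kernel (?l t) v" for t
    unfolding kernel_def
  proof
    show "fst v * u\<^sub>x\<^sub>x (?l t) + snd v * u\<^sub>x\<^sub>y (?l t) = 0"
      by (rule real_analytic_identity[of UNIV "\<lambda>t. fst v * u\<^sub>x\<^sub>x (?l t) + snd v * u\<^sub>x\<^sub>y (?l t)" 0])
         (use near line an in \<open>auto intro!: real_analytic_at_add real_analytic_at_mult
            real_analytic_at_const elim: eventually_mono\<close>)
    show "fst v * u\<^sub>x\<^sub>y (?l t) + snd v * u\<^sub>y\<^sub>y (?l t) = 0"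
      by (rule real_analytic_identity[of UNIV "\<lambda>t. fst v * u\<^sub>x\<^sub>y (?l t) + snd v * u\<^sub>y\<^sub>y (?l t)" 0])
         (use near line an in \<open>auto intro!: real_analytic_at_add real_analytic_at_mult
            real_analytic_at_const elim: eventually_mono\<close>)
  qed
  then have "((\<lambda>s. u\<^sub>x (?l s)) has_real_derivative 0) (at t)"
    "((\<lambda>s. u\<^sub>y (?l s)) has_real_derivative 0) (at t)" for t
    using DERIV_along_line[OF analytic_first(1) line, of t] DERIV_along_line[OF analytic_first(2) line, of t]
      partial_x_u\<^sub>y[OF line, of t] by (simp_all add: kernel_def)
  then have "u\<^sub>x (?l t) = u\<^sub>x (?l 0)" "u\<^sub>y (?l t) = u\<^sub>y (?l 0)"
    using DERIV_isconst_all[of "\<lambda>s. u\<^sub>x (?l s)" t 0] DERIV_isconst_all[of "\<lambda>s. u\<^sub>y (?l s)" t 0] by auto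
  then show "u\<^sub>x (z + t *\<^sub>R v) = u\<^sub>x z" "u\<^sub>y (z + t *\<^sub>R v) = u\<^sub>y z" by simp_all
qed

section \<open>The kernel field of the Hessian\<close>

lemma open_nonzero:
  assumes "\<And>z. z \<notin> F \<Longrightarrow> isCont f z"
  shows "open {z. z \<notin> F \<and> f z \<noteq> (0::real)}"
proof -
  have "open (- F \<inter> f -` (- {0}))"
    by (rule continuous_open_preimage) (use assms open_domain in \<open>auto intro: continuous_at_imp_continuous_on\<close>)
  also have "- F \<inter> f -` (- {0}) = {z. z \<notin> F \<and> f z \<noteq> 0}" by auto
  finally show ?thesis .
qed

lemma isCont_second:
  assumes "z \<notin> F" shows "isCont u\<^sub>x\<^sub>x z" "isCont u\<^sub>x\<^sub>y z" "isCont u\<^sub>y\<^sub>y z"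
  using analytic_second[THEN real_analytic_on_imp_isCont] assms by auto

lemma open_not_kernel: "open {z. z \<notin> F \<and> \<not> kernel z (e + k *\<^sub>R z)}"
proof -
  let ?X = "\<lambda>z. e + k *\<^sub>R z"
  have "{z. z \<notin> F \<and> \<not> kernel z (?X z)} =
      {z. z \<notin> F \<and> fst (?X z) * u\<^sub>x\<^sub>x z + snd (?X z) * u\<^sub>x\<^sub>y z \<noteq> 0} \<union>
      {z. z \<notin> F \<and> fst (?X z) * u\<^sub>x\<^sub>y z + snd (?X z) * u\<^sub>y\<^sub>y z \<noteq> 0}"
    by (auto simp: kernel_def)
  then show ?thesis
    by (auto intro!: open_Un open_nonzero continuous_intros isCont_second)
qed

text \<open>Each kernel equation for an affine field is a combination of functions analytic along
  lines. The parameters cover the constant field (\<open>k = 0\<close>) and the radial field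
  (\<open>k = 1\<close>, \<open>e = - q\<close>) at once.\<close>

lemma kernel_identity:
  assumes "open U" "U \<noteq> {}" "U \<subseteq> - F" and "\<And>z. z \<in> U \<Longrightarrow> kernel z (e + k *\<^sub>R z)" and "z \<notin> F"
  shows "kernel z (e + k *\<^sub>R z)"
proof -
  have X: "analytic_along_lines (- F) (\<lambda>z. fst (e + k *\<^sub>R z))"
    "analytic_along_lines (- F) (\<lambda>z. snd (e + k *\<^sub>R z))"
    using analytic_along_lines_fst analytic_along_lines_snd
    by (auto intro!: analytic_along_lines_add analytic_along_lines_mult analytic_along_lines_const)
  note id = analytic_along_lines_identity[OF open_domain connected_domain _ assms(1-3)]
  show ?thesis
    unfolding kernel_def
  proof
    show "fst (e + k *\<^sub>R z) * u\<^sub>x\<^sub>x z + snd (e + k *\<^sub>R z) * u\<^sub>x\<^sub>y z = 0"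
      by (rule id[of "\<lambda>z. fst (e + k *\<^sub>R z) * u\<^sub>x\<^sub>x z + snd (e + k *\<^sub>R z) * u\<^sub>x\<^sub>y z"])
         (use assms(4,5) in \<open>auto simp: kernel_def simp del: fst_add snd_add fst_scaleR snd_scaleR
            intro!: analytic_along_lines_add analytic_along_lines_mult
            analytic_along_lines_second X\<close>)
    show "fst (e + k *\<^sub>R z) * u\<^sub>x\<^sub>y z + snd (e + k *\<^sub>R z) * u\<^sub>y\<^sub>y z = 0"
      by (rule id[of "\<lambda>z. fst (e + k *\<^sub>R z) * u\<^sub>x\<^sub>y z + snd (e + k *\<^sub>R z) * u\<^sub>y\<^sub>y z"])
         (use assms(4,5) in \<open>auto simp: kernel_def simp del: fst_add snd_add fst_scaleR snd_scaleR
            intro!: analytic_along_lines_add analytic_along_lines_mult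
            analytic_along_lines_second X\<close>)
  qed
qed

text \<open>A Hessian row with nonzero diagonal entry, turned by a right angle, is a kernel vector:
  its own row equation is trivial and the other is the vanishing determinant.\<close>

lemma kernel_exists:
  assumes "z \<notin> F" "u\<^sub>x\<^sub>x z \<noteq> 0 \<or> u\<^sub>y\<^sub>y z \<noteq> 0"
  obtains v where "v \<noteq> 0" "kernel z v"
proof (cases "u\<^sub>x\<^sub>x z = 0")
  case True
  with that[of "(u\<^sub>y\<^sub>y z, - u\<^sub>x\<^sub>y z)"] show thesis
    using assms hessian_det[OF assms(1)] by (auto simp: kernel_def power2_eq_square zero_prod_def)
next
  case False
  with that[of "(- u\<^sub>x\<^sub>y z, u\<^sub>x\<^sub>x z)"] show thesis
    using assms hessian_det[OF assms(1)] by (auto simp: kernel_def power2_eq_square zero_prod_def)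
qed

lemma kernel_parallel:
  assumes v: "kernel z v" "v \<noteq> 0" and par: "fst w * snd v = snd w * fst v"
  shows "kernel z w"
proof -
  have k: "fst v * u\<^sub>x\<^sub>x z + snd v * u\<^sub>x\<^sub>y z = 0" "fst v * u\<^sub>x\<^sub>y z + snd v * u\<^sub>y\<^sub>y z = 0"
    using v by (auto simp: kernel_def)
  obtain r where "w = r *\<^sub>R v"
  proof (cases "fst v = 0")
    case True
    then have "snd v \<noteq> 0" using v by (auto simp: prod_eq_iff)
    with True par have "w = (snd w / snd v) *\<^sub>R v" by (auto simp: prod_eq_iff)
    then show thesis by (rule that)
  next
    case False
    with par have "w = (fst w / fst v) *\<^sub>R v" by (auto simp: prod_eq_iff field_simps)
    then show thesis by (rule that)
  qed
  then have "fst w * u\<^sub>x\<^sub>x z + snd w * u\<^sub>x\<^sub>y z = r * (fst v * u\<^sub>x\<^sub>x z + snd v * u\<^sub>x\<^sub>y z)"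
    "fst w * u\<^sub>x\<^sub>y z + snd w * u\<^sub>y\<^sub>y z = r * (fst v * u\<^sub>x\<^sub>y z + snd v * u\<^sub>y\<^sub>y z)"
    by (simp_all add: algebra_simps)
  then show ?thesis using k by (simp add: kernel_def)
qed

lemma hessian_zero_if_gradient_constant:
  assumes N: "open N" "N \<subseteq> - F" "\<And>w. w \<in> N \<Longrightarrow> u\<^sub>x w = \<alpha>" "\<And>w. w \<in> N \<Longrightarrow> u\<^sub>y w = \<beta>" and "w \<in> N"
  shows "u\<^sub>x\<^sub>x w = 0" "u\<^sub>y\<^sub>y w = 0"
proof -
  have "partial_x (\<lambda>_. k) w = 0" "partial_y (\<lambda>_. k) w = 0" for k
    by (simp_all add: partial_x_def partial_y_def case_prod_beta)
  then show "u\<^sub>x\<^sub>x w = 0" "u\<^sub>y\<^sub>y w = 0"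
    using partial_cong(1)[OF N(1) \<open>w \<in> N\<close> N(3)] partial_cong(2)[OF N(1) \<open>w \<in> N\<close> N(4)] by simp_all
qed

text \<open>
  Two non-parallel kernel lines meet, so they carry the same gradient; but where the Hessian does
  not vanish the gradient is not constant on any open set.
\<close>

lemma kernel_constant_if_lines_avoid:
  assumes B: "open B" "B \<subseteq> - F" and nz: "\<And>z. z \<in> B \<Longrightarrow> u\<^sub>x\<^sub>x z \<noteq> 0 \<or> u\<^sub>y\<^sub>y z \<noteq> 0"
    and avoid: "\<And>z v t. z \<in> B \<Longrightarrow> kernel z v \<Longrightarrow> z + t *\<^sub>R v \<notin> F"
    and z\<^sub>0: "z\<^sub>0 \<in> B" "kernel z\<^sub>0 v\<^sub>0" "v\<^sub>0 \<noteq> 0" and z: "z \<in> B"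
  shows "kernel z v\<^sub>0"
proof (rule ccontr)
  assume "\<not> kernel z v\<^sub>0"
  \<comment> \<open>An open neighbourhood of \<open>z\<close> in which no kernel line is parallel to
    \<open>v\<^sub>0\<close>; every such line meets the one through
    \<open>z\<^sub>0\<close>.\<close>
  define N where "N = B \<inter> {w. w \<notin> F \<and> \<not> kernel w (v\<^sub>0 + 0 *\<^sub>R w)}"
  have N: "open N" "N \<subseteq> - F" "z \<in> N"
    using B z \<open>\<not> kernel z v\<^sub>0\<close> open_not_kernel[of v\<^sub>0 0] by (auto simp: N_def)
  have "u\<^sub>x w = u\<^sub>x z\<^sub>0 \<and> u\<^sub>y w = u\<^sub>y z\<^sub>0" if "w \<in> N" for w
  proof -
    have w: "w \<in> B" "w \<notin> F" "\<not> kernel w v\<^sub>0" using that by (auto simp: N_def)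
    obtain v where v: "v \<noteq> 0" "kernel w v" using kernel_exists[OF w(2) nz[OF w(1)]] .
    then have "fst v\<^sub>0 * snd v \<noteq> snd v\<^sub>0 * fst v" using kernel_parallel w(3) by blast
    then obtain s t where st: "z\<^sub>0 + s *\<^sub>R v\<^sub>0 = w + t *\<^sub>R v" using lines_intersect by blast
    have "z\<^sub>0 \<notin> F" using z\<^sub>0 B by blast
    from gradient_constant_on_kernel_line[OF this nz[OF z\<^sub>0(1)] z\<^sub>0(2) avoid[OF z\<^sub>0(1,2)], of s]
      gradient_constant_on_kernel_line[OF w(2) nz[OF w(1)] v(2) avoid[OF w(1) v(2)], of t]
    show ?thesis by (simp add: st)
  qed
  then show False
    using hessian_zero_if_gradient_constant[OF N(1,2) _ _ N(3), of "u\<^sub>x z\<^sub>0" "u\<^sub>y z\<^sub>0"] nz[OF z] by blast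
qed

text \<open>If the radial field about \<open>q\<close> is not in the kernel everywhere, the identity
  theorem makes the set \<open>W q\<close> where it fails dense as well as open. If this happens for
  all \<open>q\<close>, then on the nonempty open set \<open>B\<close> no kernel line meets
  \<open>F\<close>; the kernel direction is constant on \<open>B\<close>, hence everywhere.\<close>

lemma kernel_field_cases:
  obtains (parallel) v where "v \<noteq> 0" "\<And>z. z \<notin> F \<Longrightarrow> kernel z v"
  | (radial) q where "q \<in> F" "\<And>z. z \<notin> F \<Longrightarrow> kernel z (z - q)"
proof (cases "\<exists>z. z \<notin> F \<and> (u\<^sub>x\<^sub>x z \<noteq> 0 \<or> u\<^sub>y\<^sub>y z \<noteq> 0)")
  case False
  \<comment> \<open>With both diagonal entries zero the determinant forces
    \<open>u\<^sub>x\<^sub>y\<close> to vanish too, so any direction serves.\<close>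
  then have "kernel z (1, 0)" if "z \<notin> F" for z
  proof -
    have "u\<^sub>x\<^sub>x z = 0" "u\<^sub>y\<^sub>y z = 0" using False that by blast+
    then show ?thesis using hessian_det[OF that] by (simp add: kernel_def)
  qed
  then show thesis using parallel[of "(1, 0)"] by (simp add: zero_prod_def)
next
  case True
  define U where "U = {z. z \<notin> F \<and> u\<^sub>x\<^sub>x z \<noteq> 0} \<union> {z. z \<notin> F \<and> u\<^sub>y\<^sub>y z \<noteq> 0}"
  have U: "open U" "U \<noteq> {}" "U \<subseteq> - F"
    using True unfolding U_def by (auto intro!: open_Un open_nonzero isCont_second)
  show thesis
  proof (cases "\<exists>q\<in>F. \<forall>z. z \<notin> F \<longrightarrow> kernel z (- q + 1 *\<^sub>R z)")
    case True
    then show thesis using radial by auto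
  next
    case nonradial: False
    define W where "W q = {z. z \<notin> F \<and> \<not> kernel z (- q + 1 *\<^sub>R z)}" for q
    define B where "B = U \<inter> (\<Inter>q\<in>F. W q)"
    have "open B \<and> B \<noteq> {}"
      unfolding B_def
    proof (rule finite_Int_open_dense[OF finite_F U(1,2)])
      fix q show "open (W q)" unfolding W_def by (rule open_not_kernel)
      fix V assume q: "q \<in> F" and V: "open V" "V \<noteq> {}" "V \<subseteq> U"
      show "W q \<inter> V \<noteq> {}"
      proof
        assume disj: "W q \<inter> V = {}"
        have VF: "V \<subseteq> - F" using V U by blast
        have "kernel z (- q + 1 *\<^sub>R z)" if "z \<in> V" for z
          using disj that VF unfolding W_def by blast
        from kernel_identity[OF V(1,2) VF this] show False
          using nonradial q by blast
      qed
    qed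
    then obtain z\<^sub>0 where B: "open B" "z\<^sub>0 \<in> B" by blast
    have BF: "B \<subseteq> - F" using U by (auto simp: B_def)
    have nz: "u\<^sub>x\<^sub>x z \<noteq> 0 \<or> u\<^sub>y\<^sub>y z \<noteq> 0" if "z \<in> B" for z
      using that by (auto simp: B_def U_def)
    \<comment> \<open>If the line in direction \<open>v\<close> met a point \<open>f\<close> of
      \<open>F\<close>, then \<open>z - f\<close> would be a multiple of \<open>v\<close>, hence in
      the kernel, against \<open>z\<close> lying in \<open>W f\<close>.\<close>
    have avoid: "z + t *\<^sub>R v \<notin> F" if z: "z \<in> B" and v: "kernel z v" for z v t
    proof
      assume F: "z + t *\<^sub>R v \<in> F"
      then have "\<not> kernel z (- (z + t *\<^sub>R v) + 1 *\<^sub>R z)" using z by (auto simp: B_def W_def)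
      moreover have "- (z + t *\<^sub>R v) + 1 *\<^sub>R z = - t *\<^sub>R v" by simp
      moreover have "kernel z (- t *\<^sub>R v)"
      proof (cases "v = 0")
        case True
        then show ?thesis by (simp add: kernel_def)
      next
        case False
        then show ?thesis by (intro kernel_parallel[OF v]) auto
      qed
      ultimately show False by simp
    qed
    obtain v\<^sub>0 where v\<^sub>0: "v\<^sub>0 \<noteq> 0" "kernel z\<^sub>0 v\<^sub>0"
      using kernel_exists[OF _ nz[OF B(2)]] B BF by blast
    have "kernel z v\<^sub>0" if "z \<notin> F" for z
      using kernel_identity[OF B(1) _ BF, of v\<^sub>0 0 z] B that
        kernel_constant_if_lines_avoid[OF B(1) BF nz avoid B(2) v\<^sub>0(2,1)] by auto
    with v\<^sub>0 show thesis using parallel by blast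
  qed
qed

section \<open>Removing singularities along an affine field\<close>

text \<open>Changing \<open>u\<close> at the one point \<open>q\<close> to the value of
  \<open>G\<close> gives a function that is analytic near \<open>q\<close> through \<open>G\<close>
  and elsewhere through \<open>u\<close>; an analytic function is twice continuously
  differentiable.\<close>

lemma not_singular_if_analytic_near:
  assumes q: "q \<in> F" and G: "has_power_series_at G c r q"
    and N: "open N" "q \<in> N" "\<And>z. z \<in> N \<Longrightarrow> z \<notin> F \<Longrightarrow> u z = G z"
  shows "\<not> singular_at (- F) u q"
proof -
  define v where "v z = (if z = q then G q else u z)" for z
  have "- (F - {q}) = insert q (- F)" using q by auto
  then have op: "open (insert q (- F))"
    using finite_F by (metis finite_Diff finite_imp_closed open_Compl)
  have "\<exists>c r. has_power_series_at v c r z" if z: "z \<in> insert q (- F)" for z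
  proof (cases "z = q")
    case True
    have "open (N \<inter> insert q (- F))" by (rule open_Int[OF N(1) op])
    moreover have "q \<in> N \<inter> insert q (- F)" using N by simp
    moreover have "v w = G w" if "w \<in> N \<inter> insert q (- F)" for w
      using that N(3)[of w] by (auto simp: v_def)
    ultimately show ?thesis
      using has_power_series_at_transform[OF G] True by metis
  next
    case False
    then have z: "z \<in> - F" using z by simp
    obtain c r where u: "has_power_series_at u c r z"
      using analytic z unfolding real_analytic_on_iff by blast
    have "v w = u w" if "w \<in> - F" for w using that q by (auto simp: v_def)
    then show ?thesis using has_power_series_at_transform[OF u open_domain z] by metis
  qed
  then have "C2_on (insert q (- F)) v"
    by (intro C2_on_real_analytic op) (auto simp: real_analytic_on_iff)
  moreover have "\<forall>z\<in>- F. v z = u z" using q by (auto simp: v_def)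
  ultimately show ?thesis unfolding singular_at_def by blast
qed

text \<open>For the field \<open>X(z) = e + k z\<close>, differentiating
  \<open>X . grad u - k u\<close> makes the two terms \<open>k grad u\<close> cancel and leaves the
  Hessian applied to \<open>X\<close>, which is zero. The domain is connected.\<close>

lemma affine_field_first_integral:
  assumes ker: "\<And>z. z \<notin> F \<Longrightarrow> kernel z (e + k *\<^sub>R z)"
  obtains C where
    "\<And>z. z \<notin> F \<Longrightarrow> fst (e + k *\<^sub>R z) * u\<^sub>x z + snd (e + k *\<^sub>R z) * u\<^sub>y z = k * u z + C"
proof -
  define g where "g z = fst (e + k *\<^sub>R z) * u\<^sub>x z + snd (e + k *\<^sub>R z) * u\<^sub>y z - k * u z" for z
  have "(g has_derivative (\<lambda>h. 0)) (at z)" if z: "z \<in> - F" for z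
  proof -
    have k: "fst (e + k *\<^sub>R z) * u\<^sub>x\<^sub>x z + snd (e + k *\<^sub>R z) * u\<^sub>x\<^sub>y z = 0"
      "fst (e + k *\<^sub>R z) * u\<^sub>x\<^sub>y z + snd (e + k *\<^sub>R z) * u\<^sub>y\<^sub>y z = 0"
      using ker[of z] z by (auto simp: kernel_def)
    have "(g has_derivative (\<lambda>h. fst h * (fst (e + k *\<^sub>R z) * u\<^sub>x\<^sub>x z + snd (e + k *\<^sub>R z) * u\<^sub>x\<^sub>y z)
        + snd h * (fst (e + k *\<^sub>R z) * u\<^sub>x\<^sub>y z + snd (e + k *\<^sub>R z) * u\<^sub>y\<^sub>y z))) (at z)"
      unfolding g_def
      using real_analytic_on_has_derivative[OF analytic open_domain z]
        real_analytic_on_has_derivative[OF analytic_first(1) open_domain z]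
        real_analytic_on_has_derivative[OF analytic_first(2) open_domain z] partial_x_u\<^sub>y[of z] z
      by (auto intro!: derivative_eq_intros simp: fun_eq_iff algebra_simps)
    then show ?thesis unfolding k by simp
  qed
  then have const: "g z = g w" if "z \<notin> F" "w \<notin> F" for z w
    using has_derivative_zero_unique_connected[OF open_domain connected_domain, of g z w] that by simp
  have "infinite (UNIV :: (real \<times> real) set)"
    by (simp add: finite_prod infinite_UNIV_char_0)
  then obtain z\<^sub>0 where "z\<^sub>0 \<notin> F"
    using finite_F by (metis ex_new_if_finite)
  from const[OF _ this] show thesis
    by (intro that[of "g z\<^sub>0"]) (simp add: g_def algebra_simps)
qed

text \<open>Along the line from \<open>z\<close> in the direction \<open>v = X(z)\<close> the field
  is \<open>(1 + k t) v\<close>, so \<open>v\<close> stays in the kernel as long as this factor is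
  nonzero. The directional derivative of \<open>u\<close> is then constant, with the value
  \<open>k * u z + C\<close> given by the first integral.\<close>

lemma affine_along_field:
  assumes ker: "\<And>z. z \<notin> F \<Longrightarrow> kernel z (e + k *\<^sub>R z)"
    and C: "\<And>z. z \<notin> F \<Longrightarrow> fst (e + k *\<^sub>R z) * u\<^sub>x z + snd (e + k *\<^sub>R z) * u\<^sub>y z = k * u z + C"
    and seg: "\<And>t. t \<in> closed_segment 0 s \<Longrightarrow> z + t *\<^sub>R (e + k *\<^sub>R z) \<notin> F"
    and pos: "\<And>t. t \<in> closed_segment 0 s \<Longrightarrow> 1 + k * t \<noteq> 0"
  shows "u (z + s *\<^sub>R (e + k *\<^sub>R z)) = (1 + k * s) * u z + s * C"
proof -
  define v where "v = e + k *\<^sub>R z"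
  define S where "S = closed_segment 0 s"
  have S: "convex S" "0 \<in> S" "s \<in> S" by (auto simp: S_def)
  let ?l = "\<lambda>t. z + t *\<^sub>R v"
  have l: "?l t \<notin> F" if "t \<in> S" for t using seg[of t] that by (simp add: S_def v_def)
  have z: "z \<notin> F" using l[OF S(2)] by simp
  have kerv: "kernel (?l t) v" if "t \<in> S" for t
  proof (cases "v = 0")
    case True
    then show ?thesis by (simp add: kernel_def)
  next
    case False
    have eq: "e + k *\<^sub>R ?l t = (1 + k * t) *\<^sub>R v"
      by (simp add: v_def algebra_simps)
    have "1 + k * t \<noteq> 0" using pos that by (simp add: S_def)
    have "kernel (?l t) ((1 + k * t) *\<^sub>R v)" using ker[OF l[OF that]] by (simp only: eq)
    then show ?thesis
      by (rule kernel_parallel) (use False \<open>1 + k * t \<noteq> 0\<close> in simp_all)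
  qed
  let ?g = "\<lambda>t. fst v * u\<^sub>x (?l t) + snd v * u\<^sub>y (?l t)"
  have "(?g has_real_derivative 0) (at t within S)" if t: "t \<in> S" for t
  proof -
    have "(?g has_real_derivative fst v * (fst v * u\<^sub>x\<^sub>x (?l t) + snd v * u\<^sub>x\<^sub>y (?l t)) +
        snd v * (fst v * u\<^sub>x\<^sub>y (?l t) + snd v * u\<^sub>y\<^sub>y (?l t))) (at t)"
      using DERIV_along_line[OF analytic_first(1) l[OF t]] DERIV_along_line[OF analytic_first(2) l[OF t]]
        partial_x_u\<^sub>y[OF l[OF t]]
      by (auto intro!: derivative_eq_intros)
    then show ?thesis
      using kerv[OF t] by (simp add: kernel_def has_field_derivative_at_within)
  qed
  then obtain c where c: "\<forall>t\<in>S. ?g t = c"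
    using has_field_derivative_zero_constant[OF S(1), of ?g] by blast
  have "?g t = ?g 0" if "t \<in> S" for t
    using c[rule_format, OF S(2)] c[rule_format, OF that] by simp
  moreover have "?g 0 = k * u z + C" using C[OF z] by (simp add: v_def)
  ultimately have g: "?g t = k * u z + C" if "t \<in> S" for t using that by simp
  let ?h = "\<lambda>t. u (?l t) - t * (k * u z + C)"
  have "(?h has_real_derivative 0) (at t within S)" if t: "t \<in> S" for t
  proof -
    have "(?h has_real_derivative ?g t - (k * u z + C)) (at t)"
      by (auto intro!: derivative_eq_intros DERIV_along_line[OF analytic l[OF t]])
    then show ?thesis
      using g[OF t] by (simp add: has_field_derivative_at_within)
  qed
  then obtain c where c: "\<forall>t\<in>S. ?h t = c"
    using has_field_derivative_zero_constant[OF S(1), of ?h] by blast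
  have "?h s = ?h 0"
    using c[rule_format, OF S(2)] c[rule_format, OF S(3)] by simp
  then show ?thesis by (simp add: v_def algebra_simps)
qed

text \<open>
  The affine behaviour along the field \<^term>\<open>\<lambda>z. e + k *\<^sub>R z\<close> expresses \<^term>\<open>u\<close> near \<^term>\<open>q\<close> by its values
  near a regular point further along the field. A priori this holds only off the finitely many
  field lines through points of \<^term>\<open>F\<close>, whose complement is dense.
\<close>

lemma not_singular_off_zeros:
  assumes ker: "\<And>z. z \<notin> F \<Longrightarrow> kernel z (e + k *\<^sub>R z)" and k: "0 \<le> k"
    and q: "q \<in> F" "e + k *\<^sub>R q \<noteq> 0"
  shows "\<not> singular_at (- F) u q"
proof -
  let ?X = "\<lambda>z. e + k *\<^sub>R z"
  obtain C where C: "\<And>z. z \<notin> F \<Longrightarrow> fst (?X z) * u\<^sub>x z + snd (?X z) * u\<^sub>y z = k * u z + C"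
    using affine_field_first_integral[OF ker] by blast
  \<comment> \<open>The line from \<open>q\<close> along the field meets \<open>F\<close> for only
    finitely many parameters, so some positive \<open>s\<close> leads to a regular point.\<close>
  have "inj (\<lambda>s. q + s *\<^sub>R ?X q)" using q by (auto simp: inj_def)
  then have "finite ((\<lambda>s. q + s *\<^sub>R ?X q) -` F)" by (rule finite_vimageI[OF finite_F])
  then have "infinite ({0<..} - (\<lambda>s. q + s *\<^sub>R ?X q) -` F)"
    by (rule Diff_infinite_finite) (rule infinite_Ioi)
  then obtain s where s: "0 < s" "q + s *\<^sub>R ?X q \<notin> F"
    by (metis (no_types, lifting) DiffD1 DiffD2 all_not_in_conv finite.emptyI greaterThan_iff vimageI)
  define l where "l = 1 + k * s"
  have l: "0 < l" using k s by (simp add: l_def add_pos_nonneg)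
  have shift: "z + s *\<^sub>R ?X z = s *\<^sub>R e + l *\<^sub>R z" for z
    by (simp add: l_def algebra_simps)
  \<comment> \<open>\<open>G\<close> is the relation
    \<open>u (s *\<^sub>R e + l *\<^sub>R z) = l * u z + s * C\<close> solved for
    \<open>u z\<close>. It needs \<open>u\<close> only near the image of \<open>z\<close>, which is
    regular for \<open>z = q\<close>.\<close>
  define G where "G z = 1 / l * u (s *\<^sub>R e + l *\<^sub>R z) + (- s * C / l)" for z
  obtain c r where "has_power_series_at u c r (s *\<^sub>R e + l *\<^sub>R q)"
    using analytic s unfolding real_analytic_on_iff shift by blast
  from has_power_series_at_affine[OF this] l
  obtain c' r' where G: "has_power_series_at G c' r' q"
    unfolding G_def by blast
  \<comment> \<open>\<open>P f\<close> is the field at \<open>f\<close> turned by a right angle, so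
    \<open>L\<close> collects the lines through points \<open>f\<close> of \<open>F\<close> in the
    direction of a nonzero field vector there.\<close>
  define P where "P f = (- snd (?X f), fst (?X f))" for f
  define L where "L = (\<Union>f\<in>{f \<in> F. ?X f \<noteq> 0}. {w. P f \<bullet> w = P f \<bullet> f})"
  have "negligible L"
    unfolding L_def
  proof (rule negligible_Union, goal_cases)
    case 2
    then show ?case by (auto intro!: negligible_hyperplane simp: P_def prod_eq_iff)
  qed (use finite_F in auto)
  have good: "u w = G w" if w: "w \<notin> F" "w \<notin> L" for w
  proof -
    have "w + t *\<^sub>R ?X w \<notin> F" if t: "t \<in> closed_segment 0 s" for t
    proof
      assume f: "w + t *\<^sub>R ?X w \<in> F" (is "?f \<in> F")
      have t0: "0 \<le> t" using t s by (simp add: closed_segment_eq_real_ivl)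
      \<comment> \<open>The field at the point hit is a positive multiple of the nonzero field at
        \<open>w\<close>; hence \<open>w\<close> lies on the field line through that point, which
        belongs to \<open>L\<close>.\<close>
      have Xf: "?X ?f = (1 + k * t) *\<^sub>R ?X w" by (simp add: algebra_simps)
      have "?X w \<noteq> 0" using f w(1) by auto
      moreover have "1 + k * t \<noteq> 0" using k t0 by (smt (verit) mult_nonneg_nonneg)
      ultimately have "?X ?f \<noteq> 0" using Xf by simp
      moreover have "P ?f \<bullet> w = P ?f \<bullet> ?f"
        unfolding P_def Xf by (simp add: inner_prod_def algebra_simps)
      ultimately have "w \<in> L" unfolding L_def using f by blast
      with w(2) show False by simp
    qed
    moreover have "1 + k * t \<noteq> 0" if "t \<in> closed_segment 0 s" for t
      using k that s by (smt (verit) closed_segment_eq_real_ivl atLeastAtMost_iff mult_nonneg_nonneg)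
    ultimately have "u (w + s *\<^sub>R ?X w) = (1 + k * s) * u w + s * C"
      by (intro affine_along_field ker C)
    then have "u (s *\<^sub>R e + l *\<^sub>R w) = l * u w + s * C"
      unfolding shift by (simp add: l_def)
    then show ?thesis using l by (simp add: G_def field_simps)
  qed
  define N where "N = {z. s *\<^sub>R e + l *\<^sub>R z \<notin> F}"
  have "N = (\<lambda>z. s *\<^sub>R e + l *\<^sub>R z) -` (- F)" by (auto simp: N_def)
  then have "open N" by (simp add: open_vimage open_domain continuous_intros)
  have "q \<in> N" using s by (simp add: N_def shift)
  show ?thesis
  proof (rule not_singular_if_analytic_near[OF q(1) G \<open>open N\<close> \<open>q \<in> N\<close>])
    fix z assume z: "z \<in> N" "z \<notin> F"
    have cont: "isCont (\<lambda>w. u w - G w) w" if "w \<in> N - F" for w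
    proof -
      have "isCont u w" "isCont u (s *\<^sub>R e + l *\<^sub>R w)"
        using that real_analytic_on_imp_isCont[OF analytic] by (auto simp: N_def)
      then show ?thesis unfolding G_def
        by (intro continuous_intros isCont_o2[where g = u and f = "\<lambda>w. s *\<^sub>R e + l *\<^sub>R w"])
    qed
    show "u z = G z"
    \<comment> \<open>By continuity \<open>u\<close> and \<open>G\<close> would differ on a nonempty
      open set, which cannot be contained in the negligible set \<open>L\<close>.\<close>
    proof (rule ccontr)
      assume "u z \<noteq> G z"
      define M where "M = (N - F) \<inter> (\<lambda>w. u w - G w) -` (- {0})"
      have "open (N - F)" using \<open>open N\<close> open_domain by (simp add: Diff_eq open_Int)
      then have "open M"
        unfolding M_def by (intro continuous_open_preimage)
          (use cont in \<open>auto intro: continuous_at_imp_continuous_on\<close>)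
      moreover have "z \<in> M" using z \<open>u z \<noteq> G z\<close> by (simp add: M_def)
      ultimately have "\<not> negligible M" using open_not_negligible by blast
      then have "\<not> M \<subseteq> L" using \<open>negligible L\<close> negligible_subset by blast
      then show False using good by (auto simp: M_def)
    qed
  qed
qed

section \<open>Cylindrical and conical forms\<close>

text \<open>This gives the regularity of the profile: the curve is a line in the cylindrical case
  and the unit circle about \<open>q\<close> in the conical one, where \<open>K\<close> absorbs the
  constant of the first integral.\<close>

lemma C2_on_along_curve:
  fixes g :: "real \<Rightarrow> real \<times> real"
  assumes g: "\<And>t. (g has_vector_derivative g' t) (at t)" "\<And>t. (g' has_vector_derivative g'' t) (at t)"
    and g'': "continuous_on UNIV g''" and F: "\<And>t. g t \<notin> F"
  shows "C2_on UNIV (\<lambda>t. u (g t) + K)"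
proof (rule C2_on_UNIV_real)
  fix t
  note along = real_analytic_on_has_derivative_along[OF _ open_domain _ g(1)]
  have gt: "g t \<in> - F" using F by simp
  have fs: "((\<lambda>t. fst (g' t)) has_real_derivative fst (g'' t)) (at t)"
    "((\<lambda>t. snd (g' t)) has_real_derivative snd (g'' t)) (at t)"
    using bounded_linear.has_vector_derivative[OF bounded_linear_fst g(2)]
      bounded_linear.has_vector_derivative[OF bounded_linear_snd g(2)]
    by (simp_all add: has_real_derivative_iff_has_vector_derivative)
  show "((\<lambda>t. u (g t) + K) has_real_derivative u\<^sub>x (g t) * fst (g' t) + u\<^sub>y (g t) * snd (g' t)) (at t)"
    using along[OF analytic gt] by (auto intro!: derivative_eq_intros)
  show "((\<lambda>t. u\<^sub>x (g t) * fst (g' t) + u\<^sub>y (g t) * snd (g' t)) has_real_derivative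
      (u\<^sub>x\<^sub>x (g t) * fst (g' t) + u\<^sub>x\<^sub>y (g t) * snd (g' t)) * fst (g' t) + u\<^sub>x (g t) * fst (g'' t) +
      ((u\<^sub>x\<^sub>y (g t) * fst (g' t) + u\<^sub>y\<^sub>y (g t) * snd (g' t)) * snd (g' t) + u\<^sub>y (g t) * snd (g'' t))) (at t)"
    using along[OF analytic_first(1) gt] along[OF analytic_first(2) gt] partial_x_u\<^sub>y[OF F] fs
    by (auto intro!: derivative_eq_intros)
next
  have "continuous_on UNIV g" "continuous_on UNIV g'"
    using g by (auto intro!: continuous_at_imp_continuous_on has_vector_derivative_continuous)
  moreover have "continuous_on UNIV (\<lambda>t. f (g t))" if "real_analytic_on (- F) f" for f
  proof -
    have "continuous_on (- F) f"
      by (intro continuous_at_imp_continuous_on ballI real_analytic_on_imp_isCont[OF that])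
    from continuous_on_compose2[OF this \<open>continuous_on UNIV g\<close>] F show ?thesis by auto
  qed
  ultimately show "continuous_on UNIV (\<lambda>t.
      (u\<^sub>x\<^sub>x (g t) * fst (g' t) + u\<^sub>x\<^sub>y (g t) * snd (g' t)) * fst (g' t) + u\<^sub>x (g t) * fst (g'' t) +
      ((u\<^sub>x\<^sub>y (g t) * fst (g' t) + u\<^sub>y\<^sub>y (g t) * snd (g' t)) * snd (g' t) + u\<^sub>y (g t) * snd (g'' t)))"
    using g'' analytic_first analytic_second by (intro continuous_intros) auto
qed

text \<open>After normalising \<open>v\<close> to \<open>e2\<close>, the affine law with
  \<open>k = 0\<close>, started on the orthogonal line through the origin, is the required formula;
  its slope \<open>v0\<close> is the constant \<open>C\<close>.\<close>

lemma cylindrical_if_kernel_constant: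
  assumes "F = {}" and v: "v \<noteq> 0" "\<And>z. kernel z v"
  shows "cylindrical u"
proof -
  define e2 where "e2 = v /\<^sub>R norm v"
  define e1 where "e1 = (snd e2, - fst e2)"
  have e2: "norm e2 = 1" using v by (simp add: e2_def)
  have e1: "norm e1 = 1" "e1 \<bullet> e2 = 0"
    using e2 by (simp_all add: e1_def norm_Pair inner_prod_def norm_prod_def add.commute)
  have ker: "kernel z (e2 + 0 *\<^sub>R z)" for z
    by (rule kernel_parallel[OF v(2,1)]) (simp add: e2_def)
  obtain C where C: "\<And>z. z \<notin> F \<Longrightarrow> fst (e2 + 0 *\<^sub>R z) * u\<^sub>x z + snd (e2 + 0 *\<^sub>R z) * u\<^sub>y z = 0 * u z + C"
    using affine_field_first_integral[of e2 0] ker by blast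
  have "u (x *\<^sub>R e1 + y *\<^sub>R e2) = u (x *\<^sub>R e1) + C * y" for x y
    using affine_along_field[of e2 0 C y "x *\<^sub>R e1"] ker C \<open>F = {}\<close> by simp
  moreover have "C2_on UNIV (\<lambda>t. u (t *\<^sub>R e1) + 0)"
    by (rule C2_on_along_curve[where g' = "\<lambda>_. e1" and g'' = "\<lambda>_. 0"])
       (use \<open>F = {}\<close> in \<open>auto intro!: derivative_eq_intros\<close>)
  ultimately show ?thesis
    unfolding cylindrical_def using e1 e2 by (intro exI[of _ e1] exI[of _ e2] exI[of _ C] exI) auto
qed

text \<open>The affine law with \<open>k = 1\<close> is started on the unit circle about
  \<open>q\<close> and followed for the parameter \<open>\<rho> - 1\<close>. It yields
  \<open>u0 = - C\<close>, and the profile is \<open>u + C\<close> on the circle.\<close>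

lemma conical_if_kernel_radial:
  assumes F: "F = {q}" and ker: "\<And>z. z \<noteq> q \<Longrightarrow> kernel z (z - q)"
  shows "conical q u"
proof -
  have ker': "kernel z (- q + 1 *\<^sub>R z)" if "z \<notin> F" for z using ker[of z] that F by simp
  obtain C where C: "\<And>z. z \<notin> F \<Longrightarrow>
      fst (- q + 1 *\<^sub>R z) * u\<^sub>x z + snd (- q + 1 *\<^sub>R z) * u\<^sub>y z = 1 * u z + C"
    using affine_field_first_integral[OF ker'] by blast
  define e where "e \<theta> = (cos \<theta>, sin \<theta> :: real)" for \<theta>
  have e0: "e \<theta> \<noteq> 0" for \<theta>
    using sin_zero_abs_cos_one[of \<theta>] by (auto simp: e_def zero_prod_def)
  have "u (q + \<rho> *\<^sub>R e \<theta>) = - C + \<rho> * (u (q + e \<theta>) + C)" if "0 < \<rho>" for \<rho> \<theta>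
  proof -
    \<comment> \<open>The factor \<open>1 + t\<close> runs between 1 and \<open>\<rho>\<close>, so
      the radial segment does not reach \<open>q\<close>.\<close>
    have pos: "0 < 1 + t" if "t \<in> closed_segment 0 (\<rho> - 1)" for t
      using that \<open>0 < \<rho>\<close> by (auto simp: closed_segment_eq_real_ivl split: if_splits)
    have "q + e \<theta> + t *\<^sub>R (- q + 1 *\<^sub>R (q + e \<theta>)) = q + (1 + t) *\<^sub>R e \<theta>" for t
      by (simp add: algebra_simps)
    then have "q + e \<theta> + t *\<^sub>R (- q + 1 *\<^sub>R (q + e \<theta>)) \<notin> F"
      if "t \<in> closed_segment 0 (\<rho> - 1)" for t
      using pos[OF that] e0 F by simp
    from affine_along_field[OF ker' C this] pos
    have "u (q + e \<theta> + (\<rho> - 1) *\<^sub>R (- q + 1 *\<^sub>R (q + e \<theta>))) =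
        (1 + 1 * (\<rho> - 1)) * u (q + e \<theta>) + (\<rho> - 1) * C"
      by force
    moreover have "q + e \<theta> + (\<rho> - 1) *\<^sub>R (- q + 1 *\<^sub>R (q + e \<theta>)) = q + \<rho> *\<^sub>R e \<theta>"
      by (simp add: algebra_simps)
    ultimately show ?thesis by (simp add: algebra_simps)
  qed
  moreover have "C2_on UNIV (\<lambda>\<theta>. u (q + e \<theta>) + C)"
  proof (rule C2_on_along_curve[where g' = "\<lambda>\<theta>. (- sin \<theta>, cos \<theta>)" and g'' = "\<lambda>\<theta>. (- cos \<theta>, - sin \<theta>)"])
    fix \<theta>
    show "((\<lambda>\<theta>. q + e \<theta>) has_vector_derivative (- sin \<theta>, cos \<theta>)) (at \<theta>)"
      unfolding e_def
      by (auto intro!: derivative_eq_intros has_vector_derivative_Pair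
          simp flip: has_real_derivative_iff_has_vector_derivative)
    show "((\<lambda>\<theta>. (- sin \<theta>, cos \<theta>)) has_vector_derivative (- cos \<theta>, - sin \<theta>)) (at \<theta>)"
      by (auto intro!: derivative_eq_intros has_vector_derivative_Pair
          simp flip: has_real_derivative_iff_has_vector_derivative)
  qed (use e0 F in \<open>auto intro!: continuous_intros\<close>)
  moreover have "e (\<theta> + 2 * pi) = e \<theta>" for \<theta> by (simp add: e_def)
  ultimately show ?thesis
    unfolding conical_def e_def
    by (intro exI[of _ "- C"] exI[of _ "\<lambda>\<theta>. u (q + (cos \<theta>, sin \<theta>)) + C"]) auto
qed

end

section \<open>Counting the singular points\<close>

theorem theorem1:
  fixes n :: nat
    and p :: "nat \<Rightarrow> real \<times> real"
    and u :: "real \<times> real \<Rightarrow> real"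
  assumes distinct_points: "inj_on p {1..n}"
    and analytic: "real_analytic_on (- p ` {1..n}) u"
    and equation: "\<forall>z \<in> - p ` {1..n}.
          partial_x (partial_x u) z * partial_y (partial_y u) z - (partial_y (partial_x u) z)\<^sup>2 = 0"
    and singular: "\<forall>i \<in> {1..n}. singular_at (- p ` {1..n}) u (p i)"
  shows "(n = 0 \<and> cylindrical u) \<or> (n = 1 \<and> conical (p 1) u)"
proof -
  define F where "F = p ` {1..n}"
  interpret developable F u
    using analytic equation by unfold_locales (auto simp: F_def)
  have sing: "singular_at (- F) u q" if "q \<in> F" for q
    using that singular by (auto simp: F_def)
  have card: "card F = n" using distinct_points by (simp add: F_def card_image)
  show ?thesis
  proof (cases rule: kernel_field_cases)
    case (parallel v)
    \<comment> \<open>The constant field \<open>v\<close> has no zeros, so every point of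
      \<open>F\<close> would be removable.\<close>
    have "F = {}"
      using not_singular_off_zeros[of v 0] parallel sing by auto
    moreover from this have "n = 0" using card by simp
    ultimately show ?thesis
      using cylindrical_if_kernel_constant[OF _ parallel(1)] parallel(2) by auto
  next
    case (radial q)
    \<comment> \<open>The radial field \<open>z - q\<close> vanishes only at \<open>q\<close>, so
      any other point of \<open>F\<close> would be removable.\<close>
    have "f = q" if "f \<in> F" for f
      using not_singular_off_zeros[of "- q" 1 f] radial(2) sing that by auto
    then have F: "F = {q}" using radial(1) by blast
    then have "n = 1" using card by simp
    moreover from this have "p 1 = q" using F by (auto simp: F_def)
    ultimately show ?thesis
      using conical_if_kernel_radial[OF F] radial(2) F by auto
  qed
qed

end
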